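(* Let $(\mathcal{V}, \otimes, I, a, \ell, r, c)$ be a braided monoidal category and $(\mathcal{A},*,m,u)$ a strong right $\mathcal{V}$-actegory. Let $J\in\mathcal{A}$ be an object such that the functor $J^*:\mathcal{V}\to\mathcal{A}$, $J^*X=J*X$, has a right adjoint $J^\#$, and let $(\mathcal{A}, \lhd, J, \gamma, \lambda, \rho)$ be the induced left skew monoidal category with $A\lhd B=A*J^\#B$ described in the context. Then the family of morphisms $s^P_{A,B}:(P\lhd A)\lhd B\to(P\lhd B)\lhd A$ defined as the composite $$(P*J^\#A)*J^\#B \xrightarrow{m^{J^\#A, J^\#B}_P} P * (J^\#A \otimes J^\#B)\xrightarrow{P*c_{J^\#A,J^\#B}} P * (J^\#B \otimes J^\#A)\xrightarrow{(m^{J^\#B, J^\#A}_P)^{-1}}(P*J^\#B)*J^\#A$$ is a right braiding on $\mathcal{A}$. Furthermore, if $c$ is a symmetry, then $s$ is a right symmetry.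
   Context: A left skew monoidal category $(\mathcal{A}, \lhd, J, \gamma,\lambda,\rho)$ consists of a category $\mathcal{A}$, a functor $\lhd : \mathcal{A}\times\mathcal{A}\to\mathcal{A}$, an object $J$, and natural families of (not necessarily invertible) morphisms $\gamma_{A,B,C} : (A\lhd B)\lhd C \to A\lhd(B\lhd C)$, $\lambda_A : J\lhd A\to A$, $\rho_A : A\to A\lhd J$ such that $(A\lhd\gamma_{B,C,D})\circ\gamma_{A,B\lhd C,D}\circ(\gamma_{A,B,C}\lhd D)=\gamma_{A,B,C\lhd D}\circ\gamma_{A\lhd B,C,D}$; $\gamma_{A,B,J}\circ\rho_{A\lhd B}=A\lhd\rho_B$; $\lambda_{A\lhd B}\circ\gamma_{J,A,B}=\lambda_A\lhd B$; $\lambda_J\circ\rho_J=\mathrm{id}_J$; $(A\lhd\lambda_B)\circ\gamma_{A,J,B}\circ(\rho_A\lhd B)=\mathrm{id}_{A\lhd B}$. The constraints of the monoidal category $\mathcal{V}$ are oriented as $a_{X,Y,Z}:(X\otimes Y)\otimes Z\to X\otimes(Y\otimes Z)$, $\ell_X:I\otimes X\to X$, $r_X:X\to X\otimes I$ (all invertible), and the braiding is $c_{X,Y}:X\otimes Y\to Y\otimes X$. A strong right action of $\mathcal{V}$ on $\mathcal{A}$ is a bifunctor $*:\mathcal{A}\times\mathcal{V}\to\mathcal{A}$ with natural isomorphisms $m^{X,Y}_A:(A*X)*Y\to A*(X\otimes Y)$ and $u_A:A\to A*I$ such that $(A*a_{X,Y,Z})\circ m^{X\otimes Y,Z}_A\circ(m^{X,Y}_A*Z)=m^{X,Y\otimes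 Z}_A\circ m^{Y,Z}_{A*X}$; $m^{X,I}_A\circ u_{A*X}=A*r_X$; $(A*\ell_X)\circ m^{I,X}_A\circ(u_A*X)=\mathrm{id}_{A*X}$. $\mathcal{A}$ is then called a strong right $\mathcal{V}$-actegory. Induced structure: let $\eta_X:X\to J^\#(J*X)$ and $\epsilon_A:J*J^\#A\to A$ be the unit and counit of $J^*\dashv J^\#$. The left skew monoidal structure on $\mathcal{A}$ has tensor $A\lhd B=A*J^\#B$, unit $J$, and constraints $\gamma_{A,B,C}=(A*\tilde\gamma_{B,C})\circ m^{J^\#B,J^\#C}_A:(A*J^\#B)*J^\#C\to A*J^\#(B*J^\#C)$, $\lambda_A=\epsilon_A:J*J^\#A\to A$, $\rho_A=(A*J^\#(u_J^{-1}))\circ(A*\eta_I)\circ u_A:A\to A*J^\#J$, where $\tilde\gamma_{B,C}:J^\#B\otimes J^\#C\to J^\#(B*J^\#C)$ is the adjoint transpose of $(\epsilon_B*J^\#C)\circ(m^{J^\#B,J^\#C}_J)^{-1}:J*(J^\#B\otimes J^\#C)\to B*J^\#C$. A right braiding on a left skew monoidal category $(\mathcal{A},\lhd,J,\gamma,\lambda,\rho)$ is a natural isomorphism $s^P_{A,B}:(P\lhd A)\lhd B\to(P\lhd B)\lhd A$ such that for all $P,A,B,C$: (1) $s^{P\lhd C}_{A,B}\circ(s^P_{A,C}\lhd B)\circ s^{P\lhd A}_{B,C}=(s^P_{B,C}\lhd A)\circ s^{P\lhd B}_{A,C}\circ(s^P_{A,B}\lhd C)$; (2) $(\gamma_{P,B,C}\lhd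 A)\circ s^{P\lhd B}_{A,C}\circ(s^P_{A,B}\lhd C)=s^P_{A,B\lhd C}\circ\gamma_{P\lhd A,B,C}$; (3) $\gamma_{P\lhd C,A,B}\circ(s^P_{A,C}\lhd B)\circ s^{P\lhd A}_{B,C}=s^P_{A\lhd B,C}\circ(\gamma_{P,A,B}\lhd C)$; (4) $(P\lhd s^A_{B,C})\circ\gamma_{P,A\lhd B,C}\circ(\gamma_{P,A,B}\lhd C)=\gamma_{P,A\lhd C,B}\circ(\gamma_{P,A,C}\lhd B)\circ s^{P\lhd A}_{B,C}$. It is a right symmetry if moreover $s^P_{B,A}\circ s^P_{A,B}=\mathrm{id}_{(P\lhd A)\lhd B}$ for all $P,A,B$. *)

theory Defs
  imports Main
begin

section \<open>Categories\<close>

record ('o, 'm) cat =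
  Obj :: "'o set"
  Arr :: "'m set"
  Dom :: "'m \<Rightarrow> 'o"
  Cod :: "'m \<Rightarrow> 'o"
  Ide :: "'o \<Rightarrow> 'm" ("\<one>\<index>")
  Comp :: "'m \<Rightarrow> 'm \<Rightarrow> 'm" (infixr "\<cdot>\<index>" 55)

definition Hom :: "('o, 'm, 'z) cat_scheme \<Rightarrow> 'o \<Rightarrow> 'o \<Rightarrow> 'm set"
  where "Hom C X Y = {f \<in> Arr C. Dom C f = X \<and> Cod C f = Y}"

locale category =
  fixes C :: "('o, 'm, 'z) cat_scheme" (structure)
  assumes dom_obj: "f \<in> Arr C \<Longrightarrow> Dom C f \<in> Obj C"
    and cod_obj: "f \<in> Arr C \<Longrightarrow> Cod C f \<in> Obj C"
    and id_hom: "X \<in> Obj C \<Longrightarrow> \<one> X \<in> Hom C X X"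
    and comp_hom: "\<lbrakk>f \<in> Hom C X Y; g \<in> Hom C Y Z\<rbrakk> \<Longrightarrow> g \<cdot> f \<in> Hom C X Z"
    and id_left: "f \<in> Hom C X Y \<Longrightarrow> \<one> Y \<cdot> f = f"
    and id_right: "f \<in> Hom C X Y \<Longrightarrow> f \<cdot> \<one> X = f"
    and comp_assoc:
      "\<lbrakk>f \<in> Hom C W X; g \<in> Hom C X Y; h \<in> Hom C Y Z\<rbrakk> \<Longrightarrow> (h \<cdot> g) \<cdot> f = h \<cdot> (g \<cdot> f)"

definition inverse_arrows :: "('o, 'm, 'z) cat_scheme \<Rightarrow> 'm \<Rightarrow> 'm \<Rightarrow> bool"
  where "inverse_arrows C f g \<longleftrightarrow>
    f \<in> Arr C \<and> g \<in> Hom C (Cod C f) (Dom C f) \<and>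
    g \<cdot>\<^bsub>C\<^esub> f = \<one>\<^bsub>C\<^esub> (Dom C f) \<and> f \<cdot>\<^bsub>C\<^esub> g = \<one>\<^bsub>C\<^esub> (Cod C f)"

definition iso_arr :: "('o, 'm, 'z) cat_scheme \<Rightarrow> 'm \<Rightarrow> bool"
  where "iso_arr C f \<longleftrightarrow> (\<exists>g. inverse_arrows C f g)"

definition inv_arr :: "('o, 'm, 'z) cat_scheme \<Rightarrow> 'm \<Rightarrow> 'm"
  where "inv_arr C f = (THE g. inverse_arrows C f g)"

definition prod_cat ::
    "('o, 'm, 'z) cat_scheme \<Rightarrow> ('p, 'n, 'y) cat_scheme \<Rightarrow> ('o \<times> 'p, 'm \<times> 'n) cat"
    (infixl "\<times>\<^sub>C" 70)
  where "C \<times>\<^sub>C D =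
    \<lparr>Obj = Obj C \<times> Obj D,
     Arr = Arr C \<times> Arr D,
     Dom = map_prod (Dom C) (Dom D),
     Cod = map_prod (Cod C) (Cod D),
     Ide = map_prod (Ide C) (Ide D),
     Comp = (\<lambda>(g, g') (f, f'). (g \<cdot>\<^bsub>C\<^esub> f, g' \<cdot>\<^bsub>D\<^esub> f'))\<rparr>"

locale is_functor =
  dom_cat: category C + cod_cat: category D
  for C :: "('o, 'm, 'z) cat_scheme" and D :: "('p, 'n, 'y) cat_scheme" +
  fixes Fo :: "'o \<Rightarrow> 'p" and Fa :: "'m \<Rightarrow> 'n"
  assumes map_obj: "X \<in> Obj C \<Longrightarrow> Fo X \<in> Obj D"
    and map_hom: "f \<in> Hom C X Y \<Longrightarrow> Fa f \<in> Hom D (Fo X) (Fo Y)"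
    and map_id: "X \<in> Obj C \<Longrightarrow> Fa (\<one>\<^bsub>C\<^esub> X) = \<one>\<^bsub>D\<^esub> (Fo X)"
    and map_comp: "\<lbrakk>f \<in> Hom C X Y; g \<in> Hom C Y Z\<rbrakk> \<Longrightarrow>
      Fa (g \<cdot>\<^bsub>C\<^esub> f) = Fa g \<cdot>\<^bsub>D\<^esub> Fa f"

locale nat_trans =
  source: is_functor C D Fo Fa + target: is_functor C D Go Ga
  for C :: "('o, 'm, 'z) cat_scheme" and D :: "('p, 'n, 'y) cat_scheme"
    and Fo Fa Go Ga +
  fixes t :: "'o \<Rightarrow> 'n"
  assumes component_hom: "X \<in> Obj C \<Longrightarrow> t X \<in> Hom D (Fo X) (Go X)"
    and naturality: "f \<in> Hom C X Y \<Longrightarrow> Ga f \<cdot>\<^bsub>D\<^esub> t X = t Y \<cdot>\<^bsub>D\<^esub> Fa f"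

locale nat_iso = nat_trans +
  assumes component_iso: "X \<in> Obj C \<Longrightarrow> iso_arr D (t X)"

text \<open>The functor \<open>(Ro, Ra) : D \<rightarrow> C\<close> is right adjoint to \<open>(Lo, La) : C \<rightarrow> D\<close>, with unit \<open>\<eta>\<close> and
  counit \<open>\<epsilon>\<close>.\<close>

locale adjunction =
  unit: nat_trans C C "\<lambda>X. X" "\<lambda>f. f" "\<lambda>X. Ro (Lo X)" "\<lambda>f. Ra (La f)" \<eta> +
  counit: nat_trans D D "\<lambda>Y. Lo (Ro Y)" "\<lambda>g. La (Ra g)" "\<lambda>Y. Y" "\<lambda>g. g" \<epsilon> +
  left: is_functor C D Lo La +
  right: is_functor D C Ro Ra
  for C :: "('o, 'm, 'z) cat_scheme" and D :: "('p, 'n, 'y) cat_scheme"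
    and Lo La Ro Ra \<eta> \<epsilon> +
  assumes triangle_left: "X \<in> Obj C \<Longrightarrow> \<epsilon> (Lo X) \<cdot>\<^bsub>D\<^esub> La (\<eta> X) = \<one>\<^bsub>D\<^esub> (Lo X)"
    and triangle_right: "Y \<in> Obj D \<Longrightarrow> Ra (\<epsilon> Y) \<cdot>\<^bsub>C\<^esub> \<eta> (Ro Y) = \<one>\<^bsub>C\<^esub> (Ro Y)"

text \<open>The adjoint transpose \<open>X \<rightarrow> Ro Y\<close> of \<open>h : Lo X \<rightarrow> Y\<close>.\<close>

definition transpose ::
    "('o, 'm, 'z) cat_scheme \<Rightarrow> ('n \<Rightarrow> 'm) \<Rightarrow> ('o \<Rightarrow> 'm) \<Rightarrow> 'o \<Rightarrow> 'n \<Rightarrow> 'm"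
  where "transpose C Ra \<eta> X h = Ra h \<cdot>\<^bsub>C\<^esub> \<eta> X"


section \<open>Monoidal and skew monoidal categories\<close>

text \<open>The same record carries monoidal and left skew monoidal structures, since in both cases the
  constraints are oriented as \<open>(X \<otimes> Y) \<otimes> Z \<rightarrow> X \<otimes> (Y \<otimes> Z)\<close>, \<open>I \<otimes> X \<rightarrow> X\<close> and \<open>X \<rightarrow> X \<otimes> I\<close>.
  The tensor is written \<open>\<otimes>\<close> on objects and \<open>\<boxtimes>\<close> on arrows; whiskering by an object is \<open>\<boxtimes>\<close> with
  its identity.\<close>

record ('o, 'm) tensor_cat = "('o, 'm) cat" +
  Tensor :: "'o \<Rightarrow> 'o \<Rightarrow> 'o" (infixl "\<otimes>\<index>" 70)
  TensorArr :: "'m \<Rightarrow> 'm \<Rightarrow> 'm" (infixl "\<boxtimes>\<index>" 70)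
  Unit :: "'o"
  Assoc :: "'o \<Rightarrow> 'o \<Rightarrow> 'o \<Rightarrow> 'm"
  LUnit :: "'o \<Rightarrow> 'm"
  RUnit :: "'o \<Rightarrow> 'm"

locale tensor_category = category C
  for C :: "('o, 'm, 'z) tensor_cat_scheme" (structure) +
  assumes tensor_functor:
      "is_functor (C \<times>\<^sub>C C) C (\<lambda>(X, Y). X \<otimes> Y) (\<lambda>(f, g). f \<boxtimes> g)"
    and unit_obj: "Unit C \<in> Obj C"

locale left_skew_monoidal_category = tensor_category +
  assumes assoc_natural:
      "nat_trans (C \<times>\<^sub>C C \<times>\<^sub>C C) C
        (\<lambda>((X, Y), Z). (X \<otimes> Y) \<otimes> Z) (\<lambda>((f, g), h). (f \<boxtimes> g) \<boxtimes> h)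
        (\<lambda>((X, Y), Z). X \<otimes> (Y \<otimes> Z)) (\<lambda>((f, g), h). f \<boxtimes> (g \<boxtimes> h))
        (\<lambda>((X, Y), Z). Assoc C X Y Z)"
    and lunit_natural:
      "nat_trans C C (\<lambda>X. Unit C \<otimes> X) (\<lambda>f. \<one> (Unit C) \<boxtimes> f) (\<lambda>X. X) (\<lambda>f. f) (LUnit C)"
    and runit_natural:
      "nat_trans C C (\<lambda>X. X) (\<lambda>f. f) (\<lambda>X. X \<otimes> Unit C) (\<lambda>f. f \<boxtimes> \<one> (Unit C)) (RUnit C)"
    and skew_pentagon: "\<lbrakk>W \<in> Obj C; X \<in> Obj C; Y \<in> Obj C; Z \<in> Obj C\<rbrakk> \<Longrightarrow>
      (\<one> W \<boxtimes> Assoc C X Y Z) \<cdot> Assoc C W (X \<otimes> Y) Z \<cdot> (Assoc C W X Y \<boxtimes> \<one> Z)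
      = Assoc C W X (Y \<otimes> Z) \<cdot> Assoc C (W \<otimes> X) Y Z"
    and assoc_runit: "\<lbrakk>X \<in> Obj C; Y \<in> Obj C\<rbrakk> \<Longrightarrow>
      Assoc C X Y (Unit C) \<cdot> RUnit C (X \<otimes> Y) = \<one> X \<boxtimes> RUnit C Y"
    and lunit_assoc: "\<lbrakk>X \<in> Obj C; Y \<in> Obj C\<rbrakk> \<Longrightarrow>
      LUnit C (X \<otimes> Y) \<cdot> Assoc C (Unit C) X Y = LUnit C X \<boxtimes> \<one> Y"
    and lunit_runit: "LUnit C (Unit C) \<cdot> RUnit C (Unit C) = \<one> (Unit C)"
    and skew_triangle: "\<lbrakk>X \<in> Obj C; Y \<in> Obj C\<rbrakk> \<Longrightarrow>
      (\<one> X \<boxtimes> LUnit C Y) \<cdot> Assoc C X (Unit C) Y \<cdot> (RUnit C X \<boxtimes> \<one> Y) = \<one> (X \<otimes> Y)"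

locale monoidal_category = tensor_category +
  assumes assoc_natural_iso:
      "nat_iso (C \<times>\<^sub>C C \<times>\<^sub>C C) C
        (\<lambda>((X, Y), Z). (X \<otimes> Y) \<otimes> Z) (\<lambda>((f, g), h). (f \<boxtimes> g) \<boxtimes> h)
        (\<lambda>((X, Y), Z). X \<otimes> (Y \<otimes> Z)) (\<lambda>((f, g), h). f \<boxtimes> (g \<boxtimes> h))
        (\<lambda>((X, Y), Z). Assoc C X Y Z)"
    and lunit_natural_iso:
      "nat_iso C C (\<lambda>X. Unit C \<otimes> X) (\<lambda>f. \<one> (Unit C) \<boxtimes> f) (\<lambda>X. X) (\<lambda>f. f) (LUnit C)"
    and runit_natural_iso:
      "nat_iso C C (\<lambda>X. X) (\<lambda>f. f) (\<lambda>X. X \<otimes> Unit C) (\<lambda>f. f \<boxtimes> \<one> (Unit C)) (RUnit C)"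
    and pentagon: "\<lbrakk>W \<in> Obj C; X \<in> Obj C; Y \<in> Obj C; Z \<in> Obj C\<rbrakk> \<Longrightarrow>
      (\<one> W \<boxtimes> Assoc C X Y Z) \<cdot> Assoc C W (X \<otimes> Y) Z \<cdot> (Assoc C W X Y \<boxtimes> \<one> Z)
      = Assoc C W X (Y \<otimes> Z) \<cdot> Assoc C (W \<otimes> X) Y Z"
    and triangle: "\<lbrakk>X \<in> Obj C; Y \<in> Obj C\<rbrakk> \<Longrightarrow>
      (\<one> X \<boxtimes> LUnit C Y) \<cdot> Assoc C X (Unit C) Y \<cdot> (RUnit C X \<boxtimes> \<one> Y) = \<one> (X \<otimes> Y)"

locale braided_monoidal_category = monoidal_category +
  fixes c :: "'a \<Rightarrow> 'a \<Rightarrow> 'b"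
  assumes braid_natural_iso:
      "nat_iso (C \<times>\<^sub>C C) C
        (\<lambda>(X, Y). X \<otimes> Y) (\<lambda>(f, g). f \<boxtimes> g) (\<lambda>(X, Y). Y \<otimes> X) (\<lambda>(f, g). g \<boxtimes> f)
        (\<lambda>(X, Y). c X Y)"
    and hexagon_right: "\<lbrakk>X \<in> Obj C; Y \<in> Obj C; Z \<in> Obj C\<rbrakk> \<Longrightarrow>
      Assoc C Y Z X \<cdot> c X (Y \<otimes> Z) \<cdot> Assoc C X Y Z
      = (\<one> Y \<boxtimes> c X Z) \<cdot> Assoc C Y X Z \<cdot> (c X Y \<boxtimes> \<one> Z)"
    and hexagon_left: "\<lbrakk>X \<in> Obj C; Y \<in> Obj C; Z \<in> Obj C\<rbrakk> \<Longrightarrow>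
      inv_arr C (Assoc C Z X Y) \<cdot> c (X \<otimes> Y) Z \<cdot> inv_arr C (Assoc C X Y Z)
      = (c X Z \<boxtimes> \<one> Y) \<cdot> inv_arr C (Assoc C X Z Y) \<cdot> (\<one> X \<boxtimes> c Y Z)"

locale symmetric_monoidal_category = braided_monoidal_category +
  assumes braid_symmetry: "\<lbrakk>X \<in> Obj C; Y \<in> Obj C\<rbrakk> \<Longrightarrow> c Y X \<cdot> c X Y = \<one> (X \<otimes> Y)"


section \<open>Right braidings\<close>

text \<open>\<open>s P X Y : (P \<otimes> X) \<otimes> Y \<rightarrow> (P \<otimes> Y) \<otimes> X\<close>.\<close>

locale right_braiding = left_skew_monoidal_category +
  fixes s :: "'a \<Rightarrow> 'a \<Rightarrow> 'a \<Rightarrow> 'b"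
  assumes right_braid_natural_iso:
      "nat_iso (C \<times>\<^sub>C C \<times>\<^sub>C C) C
        (\<lambda>((P, X), Y). (P \<otimes> X) \<otimes> Y) (\<lambda>((p, f), g). (p \<boxtimes> f) \<boxtimes> g)
        (\<lambda>((P, X), Y). (P \<otimes> Y) \<otimes> X) (\<lambda>((p, f), g). (p \<boxtimes> g) \<boxtimes> f)
        (\<lambda>((P, X), Y). s P X Y)"
    and right_braid_1: "\<lbrakk>P \<in> Obj C; X \<in> Obj C; Y \<in> Obj C; Z \<in> Obj C\<rbrakk> \<Longrightarrow>
      s (P \<otimes> Z) X Y \<cdot> (s P X Z \<boxtimes> \<one> Y) \<cdot> s (P \<otimes> X) Y Z
      = (s P Y Z \<boxtimes> \<one> X) \<cdot> s (P \<otimes> Y) X Z \<cdot> (s P X Y \<boxtimes> \<one> Z)"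
    and right_braid_2: "\<lbrakk>P \<in> Obj C; X \<in> Obj C; Y \<in> Obj C; Z \<in> Obj C\<rbrakk> \<Longrightarrow>
      (Assoc C P Y Z \<boxtimes> \<one> X) \<cdot> s (P \<otimes> Y) X Z \<cdot> (s P X Y \<boxtimes> \<one> Z)
      = s P X (Y \<otimes> Z) \<cdot> Assoc C (P \<otimes> X) Y Z"
    and right_braid_3: "\<lbrakk>P \<in> Obj C; X \<in> Obj C; Y \<in> Obj C; Z \<in> Obj C\<rbrakk> \<Longrightarrow>
      Assoc C (P \<otimes> Z) X Y \<cdot> (s P X Z \<boxtimes> \<one> Y) \<cdot> s (P \<otimes> X) Y Z
      = s P (X \<otimes> Y) Z \<cdot> (Assoc C P X Y \<boxtimes> \<one> Z)"
    and right_braid_4: "\<lbrakk>P \<in> Obj C; X \<in> Obj C; Y \<in> Obj C; Z \<in> Obj C\<rbrakk> \<Longrightarrow>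
      (\<one> P \<boxtimes> s X Y Z) \<cdot> Assoc C P (X \<otimes> Y) Z \<cdot> (Assoc C P X Y \<boxtimes> \<one> Z)
      = Assoc C P (X \<otimes> Z) Y \<cdot> (Assoc C P X Z \<boxtimes> \<one> Y) \<cdot> s (P \<otimes> X) Y Z"

locale right_symmetry = right_braiding +
  assumes right_braid_symmetry: "\<lbrakk>P \<in> Obj C; X \<in> Obj C; Y \<in> Obj C\<rbrakk> \<Longrightarrow>
    s P Y X \<cdot> s P X Y = \<one> ((P \<otimes> X) \<otimes> Y)"


section \<open>Actegories and the induced structure\<close>

text \<open>\<open>ActMult T A X Y : (A * X) * Y \<rightarrow> A * (X \<otimes> Y)\<close> and \<open>ActUnit T A : A \<rightarrow> A * I\<close>.
  As for the tensor, the action has one symbol for objects and one for arrows.\<close>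

record ('a, 'f, 'x, 'g) action =
  Act :: "'a \<Rightarrow> 'x \<Rightarrow> 'a" (infixl "\<star>\<index>" 70)
  ActArr :: "'f \<Rightarrow> 'g \<Rightarrow> 'f" (infixl "\<circledast>\<index>" 70)
  ActMult :: "'a \<Rightarrow> 'x \<Rightarrow> 'x \<Rightarrow> 'f"
  ActUnit :: "'a \<Rightarrow> 'f"

locale strong_right_actegory =
  V: monoidal_category V + A: category \<A>
  for V :: "('x, 'g, 'z) tensor_cat_scheme" and \<A> :: "('a, 'f, 'y) cat_scheme" +
  fixes T :: "('a, 'f, 'x, 'g) action" (structure)
  assumes act_functor:
      "is_functor (\<A> \<times>\<^sub>C V) \<A> (\<lambda>(A, X). A \<star> X) (\<lambda>(f, g). f \<circledast> g)"
    and mult_natural_iso: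
      "nat_iso (\<A> \<times>\<^sub>C V \<times>\<^sub>C V) \<A>
        (\<lambda>((A, X), Y). (A \<star> X) \<star> Y) (\<lambda>((f, g), h). (f \<circledast> g) \<circledast> h)
        (\<lambda>((A, X), Y). A \<star> (X \<otimes>\<^bsub>V\<^esub> Y)) (\<lambda>((f, g), h). f \<circledast> (g \<boxtimes>\<^bsub>V\<^esub> h))
        (\<lambda>((A, X), Y). ActMult T A X Y)"
    and unit_natural_iso:
      "nat_iso \<A> \<A> (\<lambda>A. A) (\<lambda>f. f)
        (\<lambda>A. A \<star> Unit V) (\<lambda>f. f \<circledast> \<one>\<^bsub>V\<^esub> (Unit V)) (ActUnit T)"
    and act_pentagon: "\<lbrakk>A \<in> Obj \<A>; X \<in> Obj V; Y \<in> Obj V; Z \<in> Obj V\<rbrakk> \<Longrightarrow>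
      (\<one>\<^bsub>\<A>\<^esub> A \<circledast> Assoc V X Y Z) \<cdot>\<^bsub>\<A>\<^esub> ActMult T A (X \<otimes>\<^bsub>V\<^esub> Y) Z
        \<cdot>\<^bsub>\<A>\<^esub> (ActMult T A X Y \<circledast> \<one>\<^bsub>V\<^esub> Z)
      = ActMult T A X (Y \<otimes>\<^bsub>V\<^esub> Z) \<cdot>\<^bsub>\<A>\<^esub> ActMult T (A \<star> X) Y Z"
    and act_runit: "\<lbrakk>A \<in> Obj \<A>; X \<in> Obj V\<rbrakk> \<Longrightarrow>
      ActMult T A X (Unit V) \<cdot>\<^bsub>\<A>\<^esub> ActUnit T (A \<star> X) = \<one>\<^bsub>\<A>\<^esub> A \<circledast> RUnit V X"
    and act_lunit: "\<lbrakk>A \<in> Obj \<A>; X \<in> Obj V\<rbrakk> \<Longrightarrow>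
      (\<one>\<^bsub>\<A>\<^esub> A \<circledast> LUnit V X) \<cdot>\<^bsub>\<A>\<^esub> ActMult T A (Unit V) X
        \<cdot>\<^bsub>\<A>\<^esub> (ActUnit T A \<circledast> \<one>\<^bsub>V\<^esub> X)
      = \<one>\<^bsub>\<A>\<^esub> (A \<star> X)"

text \<open>\<open>(Jo, Ja)\<close> is the functor \<open>J\<^sup>#\<close>, with unit \<open>\<eta>\<close> and counit \<open>\<epsilon>\<close>.
  The arrow defined first is \<open>\<gamma>~\<^sub>B\<^sub>C : J\<^sup># B \<otimes> J\<^sup># C \<rightarrow> J\<^sup># (B * J\<^sup># C)\<close>.\<close>

definition induced_mult ::
    "('x, 'g, 'z) tensor_cat_scheme \<Rightarrow> ('a, 'f, 'y) cat_scheme \<Rightarrow> ('a, 'f, 'x, 'g) action \<Rightarrow> 'a \<Rightarrow>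
     ('a \<Rightarrow> 'x) \<Rightarrow> ('f \<Rightarrow> 'g) \<Rightarrow> ('x \<Rightarrow> 'g) \<Rightarrow> ('a \<Rightarrow> 'f) \<Rightarrow> 'a \<Rightarrow> 'a \<Rightarrow> 'g"
  where "induced_mult V \<A> T J Jo Ja \<eta> \<epsilon> B C =
    transpose V Ja \<eta> (Jo B \<otimes>\<^bsub>V\<^esub> Jo C)
      ((\<epsilon> B \<circledast>\<^bsub>T\<^esub> \<one>\<^bsub>V\<^esub> (Jo C)) \<cdot>\<^bsub>\<A>\<^esub> inv_arr \<A> (ActMult T J (Jo B) (Jo C)))"

definition induced_skew ::
    "('x, 'g, 'z) tensor_cat_scheme \<Rightarrow> ('a, 'f, 'y) cat_scheme \<Rightarrow> ('a, 'f, 'x, 'g) action \<Rightarrow> 'a \<Rightarrow>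
     ('a \<Rightarrow> 'x) \<Rightarrow> ('f \<Rightarrow> 'g) \<Rightarrow> ('x \<Rightarrow> 'g) \<Rightarrow> ('a \<Rightarrow> 'f) \<Rightarrow> ('a, 'f) tensor_cat"
  where "induced_skew V \<A> T J Jo Ja \<eta> \<epsilon> =
    \<lparr>Obj = Obj \<A>, Arr = Arr \<A>, Dom = Dom \<A>, Cod = Cod \<A>, Ide = Ide \<A>, Comp = Comp \<A>,
     Tensor = (\<lambda>A B. A \<star>\<^bsub>T\<^esub> Jo B),
     TensorArr = (\<lambda>f g. f \<circledast>\<^bsub>T\<^esub> Ja g),
     Unit = J,
     Assoc = (\<lambda>A B C. (\<one>\<^bsub>\<A>\<^esub> A \<circledast>\<^bsub>T\<^esub> induced_mult V \<A> T J Jo Ja \<eta> \<epsilon> B C)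
        \<cdot>\<^bsub>\<A>\<^esub> ActMult T A (Jo B) (Jo C)),
     LUnit = \<epsilon>,
     RUnit = (\<lambda>A. (\<one>\<^bsub>\<A>\<^esub> A \<circledast>\<^bsub>T\<^esub> Ja (inv_arr \<A> (ActUnit T J)))
        \<cdot>\<^bsub>\<A>\<^esub> (\<one>\<^bsub>\<A>\<^esub> A \<circledast>\<^bsub>T\<^esub> \<eta> (Unit V)) \<cdot>\<^bsub>\<A>\<^esub> ActUnit T A)\<rparr>"

definition induced_braiding ::
    "('a, 'f, 'y) cat_scheme \<Rightarrow> ('a, 'f, 'x, 'g) action \<Rightarrow>
     ('x \<Rightarrow> 'x \<Rightarrow> 'g) \<Rightarrow> ('a \<Rightarrow> 'x) \<Rightarrow> 'a \<Rightarrow> 'a \<Rightarrow> 'a \<Rightarrow> 'f"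
  where "induced_braiding \<A> T c Jo P A B =
    inv_arr \<A> (ActMult T P (Jo B) (Jo A)) \<cdot>\<^bsub>\<A>\<^esub> (\<one>\<^bsub>\<A>\<^esub> P \<circledast>\<^bsub>T\<^esub> c (Jo A) (Jo B))
      \<cdot>\<^bsub>\<A>\<^esub> ActMult T P (Jo A) (Jo B)"

end

theory Submission
  imports Defs
begin

text \<open>The proof separates what happens in \<open>V\<close> from what the right adjoint \<open>J\<^sup>#\<close> contributes.

For arbitrary objects \<open>X\<close>, \<open>Y\<close> of \<open>V\<close> the braiding acts on \<open>(P * X) * Y\<close> by
\<open>\<sigma>\<^sup>P\<^sub>X\<^sub>Y : (P * X) * Y \<rightarrow> (P * Y) * X\<close>, which is \<open>P * c\<close> conjugated by the multiplication \<open>\<mu>\<close> of the action.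
The two hexagons of \<open>c\<close>, transported along the pentagon of the action, say that swapping with a
tensor product is swapping with one factor after the other (\<open>\<sigma>_tensor_right\<close>, \<open>\<sigma>_tensor_left\<close>); the
Yang-Baxter equation then follows from naturality, as in any braided category. The morphism
\<open>s\<^sup>P\<^sub>A\<^sub>B\<close> is \<open>\<sigma>\<close> at \<open>J\<^sup># A\<close> and \<open>J\<^sup># B\<close>.

The functor \<open>J\<^sup>*\<close> is a strong morphism of actegories from \<open>V\<close> to \<open>\<A>\<close>, so its right adjoint is a lax
one: there is a natural strength \<open>J\<^sup># B \<otimes> X \<rightarrow> J\<^sup># (B * X)\<close>, compatible with associativity and units
(\<open>strength_assoc\<close>, \<open>strength_unit\<close>). Each such law is checked after transposing along the
adjunction, where the strength turns into the counit (\<open>counit_strength\<close>). The associativity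
constraint of the skew structure is \<open>\<mu>\<close> followed by a strength, so its pentagon is the pentagon of
the action together with \<open>strength_assoc\<close>, and the unit axioms reduce in the same way.

Of the axioms for a right braiding, the Yang-Baxter equation is that for \<open>\<sigma>\<close>, and the next two are
the decompositions of \<open>\<sigma>\<close> at a tensor product together with naturality of \<open>\<sigma>\<close> in the strength. The
last one (\<open>\<sigma>_strength\<close>) holds because two successive strengths amount to a single strength along
\<open>X \<otimes> Y\<close>, and that one is natural in \<open>c : X \<otimes> Y \<rightarrow> Y \<otimes> X\<close>.\<close>

section \<open>Typing rules for arrows\<close>

lemma Hom_iff: "f \<in> Hom C X Y \<longleftrightarrow> f \<in> Arr C \<and> Dom C f = X \<and> Cod C f = Y"
  by (auto simp: Hom_def)

context category
begin

text \<open>Membership in \<open>Hom\<close> leaves the intermediate object of a composite to be guessed. Stated through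
\<open>Dom\<close> and \<open>Cod\<close>, the typing conditions of the category axioms are decided by the simplifier, which
then keeps all composites bracketed to the right.\<close>

lemma ide_simps [simp]:
  assumes "X \<in> Obj C"
  shows "\<one> X \<in> Arr C" "Dom C (\<one> X) = X" "Cod C (\<one> X) = X"
  using id_hom[OF assms] by (auto simp: Hom_iff)

lemma dom_cod_obj [simp]:
  assumes "f \<in> Arr C"
  shows "Dom C f \<in> Obj C" "Cod C f \<in> Obj C"
  using assms by (auto intro: dom_obj cod_obj)

lemma comp_simps [simp]:
  assumes "f \<in> Arr C" "g \<in> Arr C" "Dom C g = Cod C f"
  shows "g \<cdot> f \<in> Arr C" "Dom C (g \<cdot> f) = Dom C f" "Cod C (g \<cdot> f) = Cod C g"
  using comp_hom[of f "Dom C f" "Cod C f" g "Cod C g"] assms by (auto simp: Hom_iff)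

lemma comp_ide [simp]:
  assumes "f \<in> Arr C"
  shows "Cod C f = X \<Longrightarrow> \<one> X \<cdot> f = f" "Dom C f = X \<Longrightarrow> f \<cdot> \<one> X = f"
  using assms id_left id_right by (auto simp: Hom_iff)

lemma assoc_simp [simp]:
  assumes "f \<in> Arr C" "g \<in> Arr C" "h \<in> Arr C" "Dom C g = Cod C f" "Dom C h = Cod C g"
  shows "(h \<cdot> g) \<cdot> f = h \<cdot> g \<cdot> f"
  using assms comp_assoc[of f "Dom C f" "Cod C f" g "Cod C g" h "Cod C h"] by (auto simp: Hom_iff)

text \<open>With composites bracketed to the right, an equation between composites has to be applied to an
initial part of a longer composite. These two rules turn an equation into that form.\<close>

lemma rewrite2:
  assumes "g \<cdot> f = k"
    and "x \<in> Arr C" "f \<in> Arr C" "g \<in> Arr C" "Dom C f = Cod C x" "Dom C g = Cod C f"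
  shows "g \<cdot> f \<cdot> x = k \<cdot> x"
  unfolding assms(1)[symmetric] by (rule assoc_simp[symmetric]) (use assms in simp_all)

lemma rewrite3:
  assumes "h \<cdot> g \<cdot> f = k"
    and "x \<in> Arr C" "f \<in> Arr C" "g \<in> Arr C" "h \<in> Arr C"
      "Dom C f = Cod C x" "Dom C g = Cod C f" "Dom C h = Cod C g"
  shows "h \<cdot> g \<cdot> f \<cdot> x = k \<cdot> x"
  unfolding assms(1)[symmetric] using assms(2-) by simp

lemma inverse_arrows_unique:
  assumes "inverse_arrows C f g" "inverse_arrows C f g'"
  shows "g = g'"
proof -
  have "(g \<cdot> f) \<cdot> g' = g \<cdot> f \<cdot> g'"
    using assms by (intro assoc_simp) (auto simp: inverse_arrows_def Hom_iff)
  then show ?thesis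
    using assms by (auto simp: inverse_arrows_def Hom_iff)
qed

lemma inverse_arrows_inv_arr: "iso_arr C f \<Longrightarrow> inverse_arrows C f (inv_arr C f)"
  unfolding iso_arr_def inv_arr_def by (blast intro: theI inverse_arrows_unique)

lemma inv_arr_simps [simp]:
  assumes "iso_arr C f"
  shows "inv_arr C f \<in> Arr C" "Dom C (inv_arr C f) = Cod C f" "Cod C (inv_arr C f) = Dom C f"
    "inv_arr C f \<cdot> f = \<one> (Dom C f)" "f \<cdot> inv_arr C f = \<one> (Cod C f)"
  using inverse_arrows_inv_arr[OF assms] by (auto simp: inverse_arrows_def Hom_iff)

lemma iso_arr_in_Arr: "iso_arr C f \<Longrightarrow> f \<in> Arr C"
  by (auto simp: iso_arr_def inverse_arrows_def)

lemma inv_arr_cancel [simp]: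
  assumes "iso_arr C f" "x \<in> Arr C"
  shows "Cod C x = Dom C f \<Longrightarrow> inv_arr C f \<cdot> f \<cdot> x = x"
    "Cod C x = Cod C f \<Longrightarrow> f \<cdot> inv_arr C f \<cdot> x = x"
proof -
  assume "Cod C x = Dom C f"
  then show "inv_arr C f \<cdot> f \<cdot> x = x"
    using assms by (subst rewrite2[OF inv_arr_simps(4)]) (simp_all add: iso_arr_in_Arr)
next
  assume "Cod C x = Cod C f"
  then show "f \<cdot> inv_arr C f \<cdot> x = x"
    using assms by (subst rewrite2[OF inv_arr_simps(5)]) (simp_all add: iso_arr_in_Arr)
qed

lemma iso_arrI:
  assumes "f \<in> Arr C" "g \<in> Arr C" "Dom C g = Cod C f" "Cod C g = Dom C f"
    "g \<cdot> f = \<one> (Dom C f)" "f \<cdot> g = \<one> (Cod C f)"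
  shows "iso_arr C f"
  using assms by (auto simp: iso_arr_def inverse_arrows_def Hom_iff)

lemma iso_arr_inv_arr [simp]: "iso_arr C f \<Longrightarrow> iso_arr C (inv_arr C f)"
  by (rule iso_arrI[of _ f]) (auto simp: iso_arr_in_Arr)

lemma iso_arr_comp [simp]:
  assumes "iso_arr C f" "iso_arr C g" "Dom C g = Cod C f"
  shows "iso_arr C (g \<cdot> f)"
  using assms by (intro iso_arrI[of _ "inv_arr C f \<cdot> inv_arr C g"]) (auto simp: iso_arr_in_Arr)

lemma iso_cancel_left:
  assumes "iso_arr C h" "h \<cdot> f = h \<cdot> g"
    and "f \<in> Arr C" "g \<in> Arr C" "Cod C f = Dom C h" "Cod C g = Dom C h"
  shows "f = g"
proof -
  have "f = inv_arr C h \<cdot> h \<cdot> f" "g = inv_arr C h \<cdot> h \<cdot> g"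
    using assms(1,3-) by simp_all
  then show ?thesis using assms(2) by simp
qed

lemma iso_cancel_right:
  assumes "iso_arr C h" "f \<cdot> h = g \<cdot> h"
    and "f \<in> Arr C" "g \<in> Arr C" "Dom C f = Cod C h" "Dom C g = Cod C h"
  shows "f = g"
proof -
  have "f = (f \<cdot> h) \<cdot> inv_arr C h" "g = (g \<cdot> h) \<cdot> inv_arr C h"
    using assms(1,3-) by (simp_all add: iso_arr_in_Arr)
  then show ?thesis using assms(2) by simp
qed

end

section \<open>Functors and natural transformations\<close>

lemma prod_cat_simps [simp]:
  "Obj (C \<times>\<^sub>C D) = Obj C \<times> Obj D" "Arr (C \<times>\<^sub>C D) = Arr C \<times> Arr D"
  "Dom (C \<times>\<^sub>C D) (f, g) = (Dom C f, Dom D g)" "Cod (C \<times>\<^sub>C D) (f, g) = (Cod C f, Cod D g)"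
  "Ide (C \<times>\<^sub>C D) (X, Y) = (Ide C X, Ide D Y)"
  "Comp (C \<times>\<^sub>C D) (h, k) (f, g) = (Comp C h f, Comp D k g)"
  by (simp_all add: prod_cat_def)

lemma category_prod_cat:
  assumes "category C" "category D"
  shows "category (C \<times>\<^sub>C D)"
proof -
  interpret C: category C by fact
  interpret D: category D by fact
  show ?thesis by unfold_locales (auto simp: Hom_iff)
qed

lemma is_functorI:
  assumes "category C" "category D"
    and "\<And>X. X \<in> Obj C \<Longrightarrow> Fo X \<in> Obj D"
    and "\<And>f. f \<in> Arr C \<Longrightarrow> Fa f \<in> Arr D \<and> Dom D (Fa f) = Fo (Dom C f) \<and> Cod D (Fa f) = Fo (Cod C f)"
    and "\<And>X. X \<in> Obj C \<Longrightarrow> Fa (Ide C X) = Ide D (Fo X)"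
    and "\<And>f g. f \<in> Arr C \<Longrightarrow> g \<in> Arr C \<Longrightarrow> Dom C g = Cod C f \<Longrightarrow>
      Fa (Comp C g f) = Comp D (Fa g) (Fa f)"
  shows "is_functor C D Fo Fa"
  using assms by (auto simp: is_functor_def is_functor_axioms_def Hom_iff)

lemma nat_transI:
  assumes "is_functor C D Fo Fa" "is_functor C D Go Ga"
    and "\<And>X. X \<in> Obj C \<Longrightarrow> t X \<in> Arr D \<and> Dom D (t X) = Fo X \<and> Cod D (t X) = Go X"
    and "\<And>f. f \<in> Arr C \<Longrightarrow> Comp D (Ga f) (t (Dom C f)) = Comp D (t (Cod C f)) (Fa f)"
  shows "nat_trans C D Fo Fa Go Ga t"
  using assms by (auto simp: nat_trans_def nat_trans_axioms_def Hom_iff)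

lemma (in is_functor) functor_simps:
  "f \<in> Arr C \<Longrightarrow> Fa f \<in> Arr D" "f \<in> Arr C \<Longrightarrow> Dom D (Fa f) = Fo (Dom C f)"
  "f \<in> Arr C \<Longrightarrow> Cod D (Fa f) = Fo (Cod C f)"
  "\<lbrakk>f \<in> Arr C; g \<in> Arr C; Dom C g = Cod C f\<rbrakk> \<Longrightarrow> Fa (g \<cdot>\<^bsub>C\<^esub> f) = Fa g \<cdot>\<^bsub>D\<^esub> Fa f"
  using map_hom[of f "Dom C f" "Cod C f"] map_comp[of f "Dom C f" "Cod C f" g "Cod C g"]
  by (auto simp: Hom_iff)

lemma (in nat_trans) natural_simps:
  "X \<in> Obj C \<Longrightarrow> t X \<in> Arr D" "X \<in> Obj C \<Longrightarrow> Dom D (t X) = Fo X"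
  "X \<in> Obj C \<Longrightarrow> Cod D (t X) = Go X"
  using component_hom[of X] by (auto simp: Hom_iff)

lemma (in nat_trans) natural_arr:
  "f \<in> Arr C \<Longrightarrow> t (Cod C f) \<cdot>\<^bsub>D\<^esub> Fa f = Ga f \<cdot>\<^bsub>D\<^esub> t (Dom C f)"
  using naturality[of f "Dom C f" "Cod C f"] by (simp add: Hom_iff)

section \<open>Monoidal and braided categories\<close>

context tensor_category
begin

lemma tensor_obj [simp]: "\<lbrakk>X \<in> Obj C; Y \<in> Obj C\<rbrakk> \<Longrightarrow> X \<otimes> Y \<in> Obj C"
  using is_functor.map_obj[OF tensor_functor, of "(X, Y)"] by simp

lemma tensor_arr_simps [simp]:
  assumes "f \<in> Arr C" "g \<in> Arr C"
  shows "f \<boxtimes> g \<in> Arr C" "Dom C (f \<boxtimes> g) = Dom C f \<otimes> Dom C g" "Cod C (f \<boxtimes> g) = Cod C f \<otimes> Cod C g"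
  using is_functor.functor_simps[OF tensor_functor, of "(f, g)"] assms by auto

lemma tensor_ide: "\<lbrakk>X \<in> Obj C; Y \<in> Obj C\<rbrakk> \<Longrightarrow> \<one> X \<boxtimes> \<one> Y = \<one> (X \<otimes> Y)"
  using is_functor.map_id[OF tensor_functor, of "(X, Y)"] by simp

lemma tensor_comp:
  assumes "f \<in> Arr C" "g \<in> Arr C" "Dom C g = Cod C f"
    "h \<in> Arr C" "k \<in> Arr C" "Dom C k = Cod C h"
  shows "(g \<cdot> f) \<boxtimes> (k \<cdot> h) = (g \<boxtimes> k) \<cdot> (f \<boxtimes> h)"
  using is_functor.functor_simps(4)[OF tensor_functor, of "(f, h)" "(g, k)"] assms by simp

declare unit_obj [simp]

text \<open>These are the functors between which the associativity constraint and a right braiding are natural.\<close>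

lemma tensor_triple_functors:
  "is_functor (C \<times>\<^sub>C C \<times>\<^sub>C C) C
    (\<lambda>((X, Y), Z). (X \<otimes> Y) \<otimes> Z) (\<lambda>((f, g), h). (f \<boxtimes> g) \<boxtimes> h)"
  "is_functor (C \<times>\<^sub>C C \<times>\<^sub>C C) C
    (\<lambda>((X, Y), Z). X \<otimes> (Y \<otimes> Z)) (\<lambda>((f, g), h). f \<boxtimes> (g \<boxtimes> h))"
  "is_functor (C \<times>\<^sub>C C \<times>\<^sub>C C) C
    (\<lambda>((X, Y), Z). (X \<otimes> Z) \<otimes> Y) (\<lambda>((f, g), h). (f \<boxtimes> h) \<boxtimes> g)"
  by (rule is_functorI;
      (intro category_prod_cat category_axioms)?; clarsimp simp: tensor_ide tensor_comp)+

lemma tensor_unit_functors: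
  "is_functor C C (\<lambda>X. X) (\<lambda>f. f)"
  "is_functor C C (\<lambda>X. Unit C \<otimes> X) (\<lambda>f. \<one> (Unit C) \<boxtimes> f)"
  "is_functor C C (\<lambda>X. X \<otimes> Unit C) (\<lambda>f. f \<boxtimes> \<one> (Unit C))"
  by (rule is_functorI;
      (intro category_axioms)?; simp add: tensor_ide tensor_comp[symmetric])+

end

context monoidal_category
begin

lemma assoc_simps [simp]:
  assumes "X \<in> Obj C" "Y \<in> Obj C" "Z \<in> Obj C"
  shows "iso_arr C (Assoc C X Y Z)" "Assoc C X Y Z \<in> Arr C"
    "Dom C (Assoc C X Y Z) = (X \<otimes> Y) \<otimes> Z" "Cod C (Assoc C X Y Z) = X \<otimes> (Y \<otimes> Z)"
  using nat_iso.component_iso[OF assoc_natural_iso, of "((X, Y), Z)"]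
    nat_trans.natural_simps[OF nat_iso.axioms(1)[OF assoc_natural_iso], of "((X, Y), Z)"] assms
  by auto

lemma lunit_simps [simp]:
  assumes "X \<in> Obj C"
  shows "LUnit C X \<in> Arr C" "Dom C (LUnit C X) = Unit C \<otimes> X" "Cod C (LUnit C X) = X"
  using nat_trans.natural_simps[OF nat_iso.axioms(1)[OF lunit_natural_iso], of X] assms by auto

lemma runit_simps [simp]:
  assumes "X \<in> Obj C"
  shows "RUnit C X \<in> Arr C" "Dom C (RUnit C X) = X" "Cod C (RUnit C X) = X \<otimes> Unit C"
  using nat_trans.natural_simps[OF nat_iso.axioms(1)[OF runit_natural_iso], of X] assms by auto

end

context braided_monoidal_category
begin

lemma braid_simps [simp]:
  assumes "X \<in> Obj C" "Y \<in> Obj C"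
  shows "iso_arr C (c X Y)" "c X Y \<in> Arr C" "Dom C (c X Y) = X \<otimes> Y" "Cod C (c X Y) = Y \<otimes> X"
  using nat_iso.component_iso[OF braid_natural_iso, of "(X, Y)"]
    nat_trans.natural_simps[OF nat_iso.axioms(1)[OF braid_natural_iso], of "(X, Y)"] assms
  by auto

lemma braid_natural:
  assumes "f \<in> Arr C" "g \<in> Arr C"
  shows "c (Cod C f) (Cod C g) \<cdot> (f \<boxtimes> g) = (g \<boxtimes> f) \<cdot> c (Dom C f) (Dom C g)"
  using nat_trans.natural_arr[OF nat_iso.axioms(1)[OF braid_natural_iso], of "(f, g)"] assms
  by auto

text \<open>Solved for the braiding of a tensor product, the only inverse left is that of the inner constraint,
which is where the action pentagon can be inserted.\<close>

lemma hexagon_left':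
  assumes [simp]: "X \<in> Obj C" "Y \<in> Obj C" "Z \<in> Obj C"
  shows "c (X \<otimes> Y) Z
    = Assoc C Z X Y \<cdot> (c X Z \<boxtimes> \<one> Y) \<cdot> inv_arr C (Assoc C X Z Y) \<cdot> (\<one> X \<boxtimes> c Y Z) \<cdot> Assoc C X Y Z"
proof -
  have "c (X \<otimes> Y) Z = Assoc C Z X Y \<cdot>
      (inv_arr C (Assoc C Z X Y) \<cdot> c (X \<otimes> Y) Z \<cdot> inv_arr C (Assoc C X Y Z)) \<cdot> Assoc C X Y Z"
    by simp
  also have "\<dots> = Assoc C Z X Y \<cdot>
      ((c X Z \<boxtimes> \<one> Y) \<cdot> inv_arr C (Assoc C X Z Y) \<cdot> (\<one> X \<boxtimes> c Y Z)) \<cdot> Assoc C X Y Z"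
    by (simp only: hexagon_left assms)
  finally show ?thesis by simp
qed

end

section \<open>Actegories\<close>

context strong_right_actegory
begin

text \<open>
Everything is phrased with whiskerings: \<open>A \<rtimes> k\<close> lets an arrow \<open>k\<close> of \<open>V\<close> act on the object \<open>A\<close>, and
\<open>f \<ltimes> X\<close> lets the object \<open>X\<close> act on an arrow \<open>f\<close> of \<open>\<A>\<close>. A diagram is then a word of whiskered
arrows, and each axiom rewrites a subword.
\<close>


abbreviation comp_act (infixr "\<bullet>" 55) where "g \<bullet> f \<equiv> g \<cdot>\<^bsub>\<A>\<^esub> f"
abbreviation comp_V (infixr "\<bullet>\<^sub>V" 55) where "g \<bullet>\<^sub>V f \<equiv> g \<cdot>\<^bsub>V\<^esub> f"
abbreviation lwhisker (infixr "\<rtimes>" 68) where "A \<rtimes> k \<equiv> \<one>\<^bsub>\<A>\<^esub> A \<circledast> k"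
abbreviation rwhisker (infixl "\<ltimes>" 69) where "f \<ltimes> X \<equiv> f \<circledast> \<one>\<^bsub>V\<^esub> X"
abbreviation \<mu> where "\<mu> \<equiv> ActMult T"

lemma act_obj [simp]: "\<lbrakk>A \<in> Obj \<A>; X \<in> Obj V\<rbrakk> \<Longrightarrow> A \<star> X \<in> Obj \<A>"
  using is_functor.map_obj[OF act_functor, of "(A, X)"] by simp

lemma act_arr_simps [simp]:
  assumes "f \<in> Arr \<A>" "k \<in> Arr V"
  shows "f \<circledast> k \<in> Arr \<A>" "Dom \<A> (f \<circledast> k) = Dom \<A> f \<star> Dom V k"
    "Cod \<A> (f \<circledast> k) = Cod \<A> f \<star> Cod V k"
  using is_functor.functor_simps[OF act_functor, of "(f, k)"] assms by auto

lemma act_ide: "\<lbrakk>A \<in> Obj \<A>; X \<in> Obj V\<rbrakk> \<Longrightarrow> A \<rtimes> \<one>\<^bsub>V\<^esub> X = \<one>\<^bsub>\<A>\<^esub> (A \<star> X)"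
  using is_functor.map_id[OF act_functor, of "(A, X)"] by simp

lemma act_comp:
  assumes "f \<in> Arr \<A>" "g \<in> Arr \<A>" "Dom \<A> g = Cod \<A> f" "h \<in> Arr V" "k \<in> Arr V" "Dom V k = Cod V h"
  shows "(g \<bullet> f) \<circledast> (k \<bullet>\<^sub>V h) = (g \<circledast> k) \<bullet> (f \<circledast> h)"
  using is_functor.functor_simps(4)[OF act_functor, of "(f, h)" "(g, k)"] assms by simp

lemma lwhisker_comp:
  "\<lbrakk>A \<in> Obj \<A>; h \<in> Arr V; k \<in> Arr V; Dom V k = Cod V h\<rbrakk> \<Longrightarrow>
    A \<rtimes> (k \<bullet>\<^sub>V h) = (A \<rtimes> k) \<bullet> (A \<rtimes> h)"
  using act_comp[of "\<one>\<^bsub>\<A>\<^esub> A" "\<one>\<^bsub>\<A>\<^esub> A" h k] by simp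

lemma rwhisker_comp:
  "\<lbrakk>X \<in> Obj V; f \<in> Arr \<A>; g \<in> Arr \<A>; Dom \<A> g = Cod \<A> f\<rbrakk> \<Longrightarrow>
    (g \<bullet> f) \<ltimes> X = (g \<ltimes> X) \<bullet> (f \<ltimes> X)"
  using act_comp[of f g "\<one>\<^bsub>V\<^esub> X" "\<one>\<^bsub>V\<^esub> X"] by simp

lemma lwhisker_iso [simp]:
  assumes "A \<in> Obj \<A>" "iso_arr V k"
  shows "iso_arr \<A> (A \<rtimes> k)"
  using assms V.iso_arr_in_Arr[OF assms(2)]
  by (intro A.iso_arrI[of _ "A \<rtimes> inv_arr V k"]) (simp_all flip: lwhisker_comp add: act_ide)

lemma rwhisker_iso [simp]:
  assumes "X \<in> Obj V" "iso_arr \<A> f"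
  shows "iso_arr \<A> (f \<ltimes> X)"
  using assms A.iso_arr_in_Arr[OF assms(2)]
  by (intro A.iso_arrI[of _ "inv_arr \<A> f \<ltimes> X"]) (simp_all flip: rwhisker_comp add: act_ide)

lemma whisker_exchange:
  assumes "f \<in> Arr \<A>" "k \<in> Arr V" "Dom \<A> f = A" "Cod \<A> f = B" "Dom V k = X" "Cod V k = Y"
  shows "(f \<ltimes> Y) \<bullet> (A \<rtimes> k) = (B \<rtimes> k) \<bullet> (f \<ltimes> X)"
  using act_comp[of "\<one>\<^bsub>\<A>\<^esub> A" f k "\<one>\<^bsub>V\<^esub> Y"] act_comp[of f "\<one>\<^bsub>\<A>\<^esub> B" "\<one>\<^bsub>V\<^esub> X" k] assms by auto

lemma mult_simps [simp]:
  assumes "A \<in> Obj \<A>" "X \<in> Obj V" "Y \<in> Obj V"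
  shows "iso_arr \<A> (\<mu> A X Y)" "\<mu> A X Y \<in> Arr \<A>" "Dom \<A> (\<mu> A X Y) = (A \<star> X) \<star> Y"
    "Cod \<A> (\<mu> A X Y) = A \<star> (X \<otimes>\<^bsub>V\<^esub> Y)"
  using nat_iso.component_iso[OF mult_natural_iso, of "((A, X), Y)"]
    nat_trans.natural_simps[OF nat_iso.axioms(1)[OF mult_natural_iso], of "((A, X), Y)"] assms
  by auto

lemma mult_natural:
  assumes "f \<in> Arr \<A>" "h \<in> Arr V" "k \<in> Arr V"
    and "Cod \<A> f = A" "Cod V h = X" "Cod V k = Y"
  shows "\<mu> A X Y \<bullet> ((f \<circledast> h) \<circledast> k)
    = (f \<circledast> (h \<boxtimes>\<^bsub>V\<^esub> k)) \<bullet> \<mu> (Dom \<A> f) (Dom V h) (Dom V k)"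
  using nat_trans.natural_arr[OF nat_iso.axioms(1)[OF mult_natural_iso], of "((f, h), k)"] assms
  by auto

lemma mult_natural_rwhisker:
  assumes "f \<in> Arr \<A>" "Cod \<A> f = A" "X \<in> Obj V" "Y \<in> Obj V"
  shows "\<mu> A X Y \<bullet> ((f \<ltimes> X) \<ltimes> Y) = (f \<ltimes> (X \<otimes>\<^bsub>V\<^esub> Y)) \<bullet> \<mu> (Dom \<A> f) X Y"
  using mult_natural[of f "\<one>\<^bsub>V\<^esub> X" "\<one>\<^bsub>V\<^esub> Y"] assms by (simp add: V.tensor_ide)

lemma mult_natural_inner:
  assumes "A \<in> Obj \<A>" "h \<in> Arr V" "Cod V h = X" "Y \<in> Obj V"
  shows "\<mu> A X Y \<bullet> ((A \<rtimes> h) \<ltimes> Y) = (A \<rtimes> (h \<boxtimes>\<^bsub>V\<^esub> \<one>\<^bsub>V\<^esub> Y)) \<bullet> \<mu> A (Dom V h) Y"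
  using mult_natural[of "\<one>\<^bsub>\<A>\<^esub> A" h "\<one>\<^bsub>V\<^esub> Y"] assms by simp

lemma mult_natural_outer:
  assumes "A \<in> Obj \<A>" "X \<in> Obj V" "k \<in> Arr V" "Cod V k = Y"
  shows "\<mu> A X Y \<bullet> ((A \<star> X) \<rtimes> k) = (A \<rtimes> (\<one>\<^bsub>V\<^esub> X \<boxtimes>\<^bsub>V\<^esub> k)) \<bullet> \<mu> A X (Dom V k)"
  using mult_natural[of "\<one>\<^bsub>\<A>\<^esub> A" "\<one>\<^bsub>V\<^esub> X" k A X Y] assms by (simp add: act_ide)

lemma act_unit_simps [simp]:
  assumes "A \<in> Obj \<A>"
  shows "iso_arr \<A> (ActUnit T A)" "ActUnit T A \<in> Arr \<A>" "Dom \<A> (ActUnit T A) = A"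
    "Cod \<A> (ActUnit T A) = A \<star> Unit V"
  using nat_iso.component_iso[OF unit_natural_iso, of A]
    nat_trans.natural_simps[OF nat_iso.axioms(1)[OF unit_natural_iso], of A] assms
  by auto

lemma act_unit_natural:
  assumes "f \<in> Arr \<A>" "Cod \<A> f = A"
  shows "ActUnit T A \<bullet> f = (f \<ltimes> Unit V) \<bullet> ActUnit T (Dom \<A> f)"
  using nat_trans.natural_arr[OF nat_iso.axioms(1)[OF unit_natural_iso], of f] assms by auto

end

section \<open>The action of a braiding\<close>

locale braided_actegory =
  strong_right_actegory V \<A> T + V: braided_monoidal_category V c
  for V :: "('x, 'g, 'z) tensor_cat_scheme" and \<A> :: "('a, 'f, 'y) cat_scheme"
    and T :: "('a, 'f, 'x, 'g) action" (structure) and c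
begin

definition \<sigma> where "\<sigma> P X Y = inv_arr \<A> (\<mu> P Y X) \<bullet> (P \<rtimes> c X Y) \<bullet> \<mu> P X Y"

lemma \<sigma>_simps [simp]:
  assumes "P \<in> Obj \<A>" "X \<in> Obj V" "Y \<in> Obj V"
  shows "iso_arr \<A> (\<sigma> P X Y)" "\<sigma> P X Y \<in> Arr \<A>" "Dom \<A> (\<sigma> P X Y) = (P \<star> X) \<star> Y"
    "Cod \<A> (\<sigma> P X Y) = (P \<star> Y) \<star> X"
  using assms by (simp_all add: \<sigma>_def)

text \<open>Multiplying by \<open>\<mu>\<close> removes the inverse in \<open>\<sigma>\<close>. As \<open>\<mu>\<close> is invertible, an equation between composites
of \<open>\<sigma>\<close> may be checked after such a multiplication.\<close>

lemma mult_\<sigma>: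
  assumes "P \<in> Obj \<A>" "X \<in> Obj V" "Y \<in> Obj V"
  shows "\<mu> P Y X \<bullet> \<sigma> P X Y = (P \<rtimes> c X Y) \<bullet> \<mu> P X Y"
  using assms by (simp add: \<sigma>_def)

lemma mult_\<sigma>_rwhisker:
  assumes "P \<in> Obj \<A>" "X \<in> Obj V" "Y \<in> Obj V" "Z \<in> Obj V"
  shows "(\<mu> P Y X \<ltimes> Z) \<bullet> (\<sigma> P X Y \<ltimes> Z) = ((P \<rtimes> c X Y) \<ltimes> Z) \<bullet> (\<mu> P X Y \<ltimes> Z)"
  using assms by (simp add: mult_\<sigma> flip: rwhisker_comp)

lemma \<sigma>_natural:
  assumes [simp]: "p \<in> Arr \<A>" "h \<in> Arr V" "k \<in> Arr V"
  shows "\<sigma> (Cod \<A> p) (Cod V h) (Cod V k) \<bullet> ((p \<circledast> h) \<circledast> k)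
    = ((p \<circledast> k) \<circledast> h) \<bullet> \<sigma> (Dom \<A> p) (Dom V h) (Dom V k)"
proof (rule A.iso_cancel_left)
  let ?P = "Dom \<A> p" and ?X = "Dom V h" and ?Y = "Dom V k"
  let ?P' = "Cod \<A> p" and ?X' = "Cod V h" and ?Y' = "Cod V k"
  have "\<mu> ?P' ?Y' ?X' \<bullet> \<sigma> ?P' ?X' ?Y' \<bullet> ((p \<circledast> h) \<circledast> k)
      = (?P' \<rtimes> c ?X' ?Y') \<bullet> (p \<circledast> (h \<boxtimes>\<^bsub>V\<^esub> k)) \<bullet> \<mu> ?P ?X ?Y"
    by (simp add: A.rewrite2[OF mult_\<sigma>] mult_natural)
  also have "\<dots> = (p \<circledast> (c ?X' ?Y' \<bullet>\<^sub>V (h \<boxtimes>\<^bsub>V\<^esub> k))) \<bullet> \<mu> ?P ?X ?Y"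
    using act_comp[of p "\<one>\<^bsub>\<A>\<^esub> ?P'" "h \<boxtimes>\<^bsub>V\<^esub> k" "c ?X' ?Y'"]
    by (simp flip: A.assoc_simp)
  also have "\<dots> = (p \<circledast> ((k \<boxtimes>\<^bsub>V\<^esub> h) \<bullet>\<^sub>V c ?X ?Y)) \<bullet> \<mu> ?P ?X ?Y"
    by (simp add: V.braid_natural)
  also have "\<dots> = (p \<circledast> (k \<boxtimes>\<^bsub>V\<^esub> h)) \<bullet> (?P \<rtimes> c ?X ?Y) \<bullet> \<mu> ?P ?X ?Y"
    using act_comp[of "\<one>\<^bsub>\<A>\<^esub> ?P" p "c ?X ?Y" "k \<boxtimes>\<^bsub>V\<^esub> h"] by simp
  also have "\<dots> = \<mu> ?P' ?Y' ?X' \<bullet> ((p \<circledast> k) \<circledast> h) \<bullet> \<sigma> ?P ?X ?Y"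
    by (simp add: A.rewrite2[OF mult_natural] flip: mult_\<sigma>)
  finally show "\<mu> ?P' ?Y' ?X' \<bullet> \<sigma> ?P' ?X' ?Y' \<bullet> ((p \<circledast> h) \<circledast> k)
      = \<mu> ?P' ?Y' ?X' \<bullet> ((p \<circledast> k) \<circledast> h) \<bullet> \<sigma> ?P ?X ?Y" .
qed simp_all

lemma \<sigma>_natural_rwhisker:
  assumes "P \<in> Obj \<A>" "h \<in> Arr V" "Z \<in> Obj V" "Cod V h = X"
  shows "\<sigma> P X Z \<bullet> ((P \<rtimes> h) \<ltimes> Z) = ((P \<star> Z) \<rtimes> h) \<bullet> \<sigma> P (Dom V h) Z"
  using \<sigma>_natural[of "\<one>\<^bsub>\<A>\<^esub> P" h "\<one>\<^bsub>V\<^esub> Z"] assms by (simp add: act_ide)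

lemma \<sigma>_natural_outer:
  assumes "P \<in> Obj \<A>" "k \<in> Arr V" "X \<in> Obj V" "Cod V k = Y"
  shows "\<sigma> P X Y \<bullet> ((P \<star> X) \<rtimes> k) = ((P \<rtimes> k) \<ltimes> X) \<bullet> \<sigma> P X (Dom V k)"
  using \<sigma>_natural[of "\<one>\<^bsub>\<A>\<^esub> P" "\<one>\<^bsub>V\<^esub> X" k] assms by (simp add: act_ide)

text \<open>Both sides become composites of \<open>\<mu>\<close> with braidings and associators of \<open>V\<close> once \<open>\<mu>\<close> and the
associator are applied to \<open>(P * (Y \<otimes> Z)) * X\<close>. The arrows of \<open>V\<close> that arise are the two sides of
the hexagon for \<open>c X (Y \<otimes> Z)\<close>.\<close>

lemma \<sigma>_tensor_right:
  assumes [simp]: "P \<in> Obj \<A>" "X \<in> Obj V" "Y \<in> Obj V" "Z \<in> Obj V"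
  shows "(\<mu> P Y Z \<ltimes> X) \<bullet> \<sigma> (P \<star> Y) X Z \<bullet> (\<sigma> P X Y \<ltimes> Z)
    = \<sigma> P X (Y \<otimes>\<^bsub>V\<^esub> Z) \<bullet> \<mu> (P \<star> X) Y Z"
proof (rule A.iso_cancel_left)
  let ?h = "(P \<rtimes> Assoc V Y Z X) \<bullet> \<mu> P (Y \<otimes>\<^bsub>V\<^esub> Z) X"
  have "?h \<bullet> (\<mu> P Y Z \<ltimes> X) \<bullet> \<sigma> (P \<star> Y) X Z \<bullet> (\<sigma> P X Y \<ltimes> Z)
      = \<mu> P Y (Z \<otimes>\<^bsub>V\<^esub> X) \<bullet> ((P \<star> Y) \<rtimes> c X Z) \<bullet> \<mu> (P \<star> Y) X Z \<bullet> (\<sigma> P X Y \<ltimes> Z)"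
    by (simp add: A.rewrite3[OF act_pentagon] A.rewrite2[OF mult_\<sigma>])
  also have "\<dots> = (P \<rtimes> (\<one>\<^bsub>V\<^esub> Y \<boxtimes>\<^bsub>V\<^esub> c X Z)) \<bullet> \<mu> P Y (X \<otimes>\<^bsub>V\<^esub> Z) \<bullet> \<mu> (P \<star> Y) X Z
      \<bullet> (\<sigma> P X Y \<ltimes> Z)"
    by (simp add: A.rewrite2[OF mult_natural_outer])
  also have "\<dots> = (P \<rtimes> (\<one>\<^bsub>V\<^esub> Y \<boxtimes>\<^bsub>V\<^esub> c X Z)) \<bullet> (P \<rtimes> Assoc V Y X Z) \<bullet> \<mu> P (Y \<otimes>\<^bsub>V\<^esub> X) Z
      \<bullet> (\<mu> P Y X \<ltimes> Z) \<bullet> (\<sigma> P X Y \<ltimes> Z)"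
    by (simp add: A.rewrite2[OF act_pentagon[symmetric]])
  also have "\<dots> = (P \<rtimes> (\<one>\<^bsub>V\<^esub> Y \<boxtimes>\<^bsub>V\<^esub> c X Z)) \<bullet> (P \<rtimes> Assoc V Y X Z)
      \<bullet> (P \<rtimes> (c X Y \<boxtimes>\<^bsub>V\<^esub> \<one>\<^bsub>V\<^esub> Z)) \<bullet> \<mu> P (X \<otimes>\<^bsub>V\<^esub> Y) Z \<bullet> (\<mu> P X Y \<ltimes> Z)"
    by (simp add: mult_\<sigma>_rwhisker A.rewrite2[OF mult_natural_inner])
  also have "\<dots> = (P \<rtimes> (Assoc V Y Z X \<bullet>\<^sub>V c X (Y \<otimes>\<^bsub>V\<^esub> Z) \<bullet>\<^sub>V Assoc V X Y Z))
      \<bullet> \<mu> P (X \<otimes>\<^bsub>V\<^esub> Y) Z \<bullet> (\<mu> P X Y \<ltimes> Z)"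
    by (simp add: lwhisker_comp V.hexagon_right)
  also have "\<dots> = (P \<rtimes> Assoc V Y Z X) \<bullet> (P \<rtimes> c X (Y \<otimes>\<^bsub>V\<^esub> Z)) \<bullet> \<mu> P X (Y \<otimes>\<^bsub>V\<^esub> Z)
      \<bullet> \<mu> (P \<star> X) Y Z"
    by (simp add: lwhisker_comp act_pentagon)
  also have "\<dots> = ?h \<bullet> \<sigma> P X (Y \<otimes>\<^bsub>V\<^esub> Z) \<bullet> \<mu> (P \<star> X) Y Z"
    by (simp add: A.rewrite2[OF mult_\<sigma>])
  finally show "?h \<bullet> (\<mu> P Y Z \<ltimes> X) \<bullet> \<sigma> (P \<star> Y) X Z \<bullet> (\<sigma> P X Y \<ltimes> Z)
      = ?h \<bullet> \<sigma> P X (Y \<otimes>\<^bsub>V\<^esub> Z) \<bullet> \<mu> (P \<star> X) Y Z" .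
qed simp_all

text \<open>The mirror image of the previous argument, with the hexagon for \<open>c (X \<otimes> Y) Z\<close>.\<close>

lemma \<sigma>_tensor_left:
  assumes [simp]: "P \<in> Obj \<A>" "X \<in> Obj V" "Y \<in> Obj V" "Z \<in> Obj V"
  shows "\<mu> (P \<star> Z) X Y \<bullet> (\<sigma> P X Z \<ltimes> Y) \<bullet> \<sigma> (P \<star> X) Y Z
    = \<sigma> P (X \<otimes>\<^bsub>V\<^esub> Y) Z \<bullet> (\<mu> P X Y \<ltimes> Z)"
proof (rule A.iso_cancel_left)
  let ?m = "\<mu> P Z (X \<otimes>\<^bsub>V\<^esub> Y)"
  let ?b = "(P \<rtimes> Assoc V Z X Y) \<bullet> (P \<rtimes> (c X Z \<boxtimes>\<^bsub>V\<^esub> \<one>\<^bsub>V\<^esub> Y))"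
  let ?a = "inv_arr V (Assoc V X Z Y)"
  have cancel: "(P \<rtimes> ?a) \<bullet> (P \<rtimes> Assoc V X Z Y) = \<one>\<^bsub>\<A>\<^esub> (P \<star> ((X \<otimes>\<^bsub>V\<^esub> Z) \<otimes>\<^bsub>V\<^esub> Y))"
    by (simp add: act_ide flip: lwhisker_comp)
  have "?m \<bullet> \<mu> (P \<star> Z) X Y \<bullet> (\<sigma> P X Z \<ltimes> Y) \<bullet> \<sigma> (P \<star> X) Y Z
      = (P \<rtimes> Assoc V Z X Y) \<bullet> \<mu> P (Z \<otimes>\<^bsub>V\<^esub> X) Y \<bullet> (\<mu> P Z X \<ltimes> Y) \<bullet> (\<sigma> P X Z \<ltimes> Y)
        \<bullet> \<sigma> (P \<star> X) Y Z"
    by (simp add: A.rewrite2[OF act_pentagon[symmetric]])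
  also have "\<dots> = ?b \<bullet> \<mu> P (X \<otimes>\<^bsub>V\<^esub> Z) Y \<bullet> (\<mu> P X Z \<ltimes> Y) \<bullet> \<sigma> (P \<star> X) Y Z"
    by (simp add: A.rewrite2[OF mult_\<sigma>_rwhisker] A.rewrite2[OF mult_natural_inner])
  \<comment> \<open>The pentagon needs an associator in front of \<open>\<mu>\<close>. It is inserted together with its inverse,
    which is the one that occurs in the hexagon.\<close>
  also have "\<dots> = ?b \<bullet> (P \<rtimes> ?a) \<bullet> (P \<rtimes> Assoc V X Z Y) \<bullet> \<mu> P (X \<otimes>\<^bsub>V\<^esub> Z) Y
      \<bullet> (\<mu> P X Z \<ltimes> Y) \<bullet> \<sigma> (P \<star> X) Y Z"
    by (simp add: A.rewrite2[OF cancel])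
  also have "\<dots> = ?b \<bullet> (P \<rtimes> ?a) \<bullet> (P \<rtimes> (\<one>\<^bsub>V\<^esub> X \<boxtimes>\<^bsub>V\<^esub> c Y Z)) \<bullet> \<mu> P X (Y \<otimes>\<^bsub>V\<^esub> Z) \<bullet> \<mu> (P \<star> X) Y Z"
    by (simp add: A.rewrite3[OF act_pentagon] mult_\<sigma> A.rewrite2[OF mult_natural_outer])
  also have "\<dots> = ?b \<bullet> (P \<rtimes> ?a) \<bullet> (P \<rtimes> (\<one>\<^bsub>V\<^esub> X \<boxtimes>\<^bsub>V\<^esub> c Y Z)) \<bullet> (P \<rtimes> Assoc V X Y Z)
      \<bullet> \<mu> P (X \<otimes>\<^bsub>V\<^esub> Y) Z \<bullet> (\<mu> P X Y \<ltimes> Z)"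
    by (simp add: act_pentagon)
  also have "\<dots> = (P \<rtimes> c (X \<otimes>\<^bsub>V\<^esub> Y) Z) \<bullet> \<mu> P (X \<otimes>\<^bsub>V\<^esub> Y) Z \<bullet> (\<mu> P X Y \<ltimes> Z)"
    by (simp add: lwhisker_comp V.hexagon_left')
  also have "\<dots> = ?m \<bullet> \<sigma> P (X \<otimes>\<^bsub>V\<^esub> Y) Z \<bullet> (\<mu> P X Y \<ltimes> Z)"
    by (simp add: A.rewrite2[OF mult_\<sigma>])
  finally show "?m \<bullet> \<mu> (P \<star> Z) X Y \<bullet> (\<sigma> P X Z \<ltimes> Y) \<bullet> \<sigma> (P \<star> X) Y Z
      = ?m \<bullet> \<sigma> P (X \<otimes>\<^bsub>V\<^esub> Y) Z \<bullet> (\<mu> P X Y \<ltimes> Z)" .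
qed simp_all

text \<open>Merging \<open>X\<close> and \<open>Y\<close> into \<open>X \<otimes> Y\<close> makes the two swaps past \<open>Z\<close> a single \<open>\<sigma>\<close>, and naturality of
that \<open>\<sigma>\<close> in the braiding \<open>X \<otimes> Y \<rightarrow> Y \<otimes> X\<close> moves the third swap from one side to the other.\<close>

lemma \<sigma>_yang_baxter:
  assumes [simp]: "P \<in> Obj \<A>" "X \<in> Obj V" "Y \<in> Obj V" "Z \<in> Obj V"
  shows "\<sigma> (P \<star> Z) X Y \<bullet> (\<sigma> P X Z \<ltimes> Y) \<bullet> \<sigma> (P \<star> X) Y Z
    = (\<sigma> P Y Z \<ltimes> X) \<bullet> \<sigma> (P \<star> Y) X Z \<bullet> (\<sigma> P X Y \<ltimes> Z)"
proof (rule A.iso_cancel_left)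
  let ?m = "\<mu> (P \<star> Z) Y X"
  have "?m \<bullet> \<sigma> (P \<star> Z) X Y \<bullet> (\<sigma> P X Z \<ltimes> Y) \<bullet> \<sigma> (P \<star> X) Y Z
      = ((P \<star> Z) \<rtimes> c X Y) \<bullet> \<sigma> P (X \<otimes>\<^bsub>V\<^esub> Y) Z \<bullet> (\<mu> P X Y \<ltimes> Z)"
    by (simp add: A.rewrite2[OF mult_\<sigma>] \<sigma>_tensor_left)
  also have "\<dots> = \<sigma> P (Y \<otimes>\<^bsub>V\<^esub> X) Z \<bullet> ((P \<rtimes> c X Y) \<ltimes> Z) \<bullet> (\<mu> P X Y \<ltimes> Z)"
    by (simp add: A.rewrite2[OF \<sigma>_natural_rwhisker])
  also have "\<dots> = \<sigma> P (Y \<otimes>\<^bsub>V\<^esub> X) Z \<bullet> (\<mu> P Y X \<ltimes> Z) \<bullet> (\<sigma> P X Y \<ltimes> Z)"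
    by (simp add: mult_\<sigma>_rwhisker)
  also have "\<dots> = ?m \<bullet> (\<sigma> P Y Z \<ltimes> X) \<bullet> \<sigma> (P \<star> Y) X Z \<bullet> (\<sigma> P X Y \<ltimes> Z)"
    by (simp add: A.rewrite2[OF \<sigma>_tensor_left[symmetric]])
  finally show "?m \<bullet> \<sigma> (P \<star> Z) X Y \<bullet> (\<sigma> P X Z \<ltimes> Y) \<bullet> \<sigma> (P \<star> X) Y Z
      = ?m \<bullet> (\<sigma> P Y Z \<ltimes> X) \<bullet> \<sigma> (P \<star> Y) X Z \<bullet> (\<sigma> P X Y \<ltimes> Z)" .
qed simp_all

lemma \<sigma>_symmetric:
  assumes [simp]: "P \<in> Obj \<A>" "X \<in> Obj V" "Y \<in> Obj V"
    and symm: "c Y X \<bullet>\<^sub>V c X Y = \<one>\<^bsub>V\<^esub> (X \<otimes>\<^bsub>V\<^esub> Y)"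
  shows "\<sigma> P Y X \<bullet> \<sigma> P X Y = \<one>\<^bsub>\<A>\<^esub> ((P \<star> X) \<star> Y)"
proof (rule A.iso_cancel_left)
  have "\<mu> P X Y \<bullet> \<sigma> P Y X \<bullet> \<sigma> P X Y = (P \<rtimes> c Y X) \<bullet> (P \<rtimes> c X Y) \<bullet> \<mu> P X Y"
    by (simp add: A.rewrite2[OF mult_\<sigma>] mult_\<sigma>)
  also have "\<dots> = (P \<rtimes> (c Y X \<bullet>\<^sub>V c X Y)) \<bullet> \<mu> P X Y"
    by (simp add: lwhisker_comp)
  also have "\<dots> = \<mu> P X Y \<bullet> \<one>\<^bsub>\<A>\<^esub> ((P \<star> X) \<star> Y)"
    by (simp add: symm act_ide)
  finally show "\<mu> P X Y \<bullet> \<sigma> P Y X \<bullet> \<sigma> P X Y = \<mu> P X Y \<bullet> \<one>\<^bsub>\<A>\<^esub> ((P \<star> X) \<star> Y)" .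
qed simp_all

end

section \<open>The strength of the right adjoint\<close>

locale actegory_right_adjoint =
  strong_right_actegory V \<A> T +
  adj: adjunction V \<A> "\<lambda>X. J \<star> X" "\<lambda>g. \<one>\<^bsub>\<A>\<^esub> J \<circledast> g" Jo Ja \<eta> \<epsilon>
  for V :: "('x, 'g, 'z) tensor_cat_scheme" and \<A> :: "('a, 'f, 'y) cat_scheme"
    and T :: "('a, 'f, 'x, 'g) action" (structure)
    and J Jo Ja \<eta> \<epsilon> +
  assumes J_obj [simp]: "J \<in> Obj \<A>"
begin

lemma Jo_obj [simp]: "A \<in> Obj \<A> \<Longrightarrow> Jo A \<in> Obj V"
  by (rule adj.right.map_obj)

lemma Ja_simps [simp]:
  assumes "f \<in> Arr \<A>"
  shows "Ja f \<in> Arr V" "Dom V (Ja f) = Jo (Dom \<A> f)" "Cod V (Ja f) = Jo (Cod \<A> f)"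
  using adj.right.functor_simps assms by auto

lemma Ja_ide [simp]: "A \<in> Obj \<A> \<Longrightarrow> Ja (\<one>\<^bsub>\<A>\<^esub> A) = \<one>\<^bsub>V\<^esub> (Jo A)"
  by (rule adj.right.map_id)

lemma Ja_comp: "\<lbrakk>f \<in> Arr \<A>; g \<in> Arr \<A>; Dom \<A> g = Cod \<A> f\<rbrakk> \<Longrightarrow> Ja (g \<bullet> f) = Ja g \<bullet>\<^sub>V Ja f"
  by (rule adj.right.functor_simps)

lemma unit_simps [simp]:
  assumes "X \<in> Obj V"
  shows "\<eta> X \<in> Arr V" "Dom V (\<eta> X) = X" "Cod V (\<eta> X) = Jo (J \<star> X)"
  using adj.unit.natural_simps assms by auto

lemma counit_simps [simp]:
  assumes "A \<in> Obj \<A>"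
  shows "\<epsilon> A \<in> Arr \<A>" "Dom \<A> (\<epsilon> A) = J \<star> Jo A" "Cod \<A> (\<epsilon> A) = A"
  using adj.counit.natural_simps assms by auto

lemma unit_natural:
  "\<lbrakk>h \<in> Arr V; Cod V h = X\<rbrakk> \<Longrightarrow> \<eta> X \<bullet>\<^sub>V h = Ja (J \<rtimes> h) \<bullet>\<^sub>V \<eta> (Dom V h)"
  using adj.unit.natural_arr[of h] by simp

lemma counit_natural:
  "\<lbrakk>f \<in> Arr \<A>; Cod \<A> f = A\<rbrakk> \<Longrightarrow> \<epsilon> A \<bullet> (J \<rtimes> Ja f) = f \<bullet> \<epsilon> (Dom \<A> f)"
  using adj.counit.natural_arr[of f] by simp

lemma counit_transpose:
  assumes "h \<in> Arr \<A>" "Dom \<A> h = J \<star> X" "X \<in> Obj V" "Cod \<A> h = A"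
  shows "\<epsilon> A \<bullet> (J \<rtimes> transpose V Ja \<eta> X h) = h"
  using assms A.dom_cod_obj(2)[of h] adj.triangle_left[of X]
  by (simp add: transpose_def lwhisker_comp A.rewrite2[OF counit_natural])

text \<open>Arrows into \<open>J\<^sup># A\<close> are determined by their transposes. This is the tool for every law of the strength.\<close>

lemma counit_eqI:
  assumes "h \<in> Arr V" "k \<in> Arr V" "Dom V h = Dom V k" "Cod V h = Jo A" "Cod V k = Jo A"
    and A: "A \<in> Obj \<A>"
    and eq: "\<epsilon> A \<bullet> (J \<rtimes> h) = \<epsilon> A \<bullet> (J \<rtimes> k)"
  shows "h = k"
proof -
  have *: "Ja (\<epsilon> A \<bullet> (J \<rtimes> f)) \<bullet>\<^sub>V \<eta> (Dom V f) = f" if "f \<in> Arr V" "Cod V f = Jo A" for f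
  proof -
    have "Ja (\<epsilon> A \<bullet> (J \<rtimes> f)) \<bullet>\<^sub>V \<eta> (Dom V f) = Ja (\<epsilon> A) \<bullet>\<^sub>V \<eta> (Jo A) \<bullet>\<^sub>V f"
      using that A by (simp add: Ja_comp unit_natural)
    also have "\<dots> = f"
      using that A by (simp add: V.rewrite2[OF adj.triangle_right])
    finally show ?thesis .
  qed
  have "h = Ja (\<epsilon> A \<bullet> (J \<rtimes> h)) \<bullet>\<^sub>V \<eta> (Dom V h)"
    by (rule *[symmetric]) fact+
  also have "\<dots> = Ja (\<epsilon> A \<bullet> (J \<rtimes> k)) \<bullet>\<^sub>V \<eta> (Dom V k)"
    by (simp only: assms(3) eq)
  also have "\<dots> = k"
    by (rule *) fact+
  finally show ?thesis .
qed

text \<open>The lax structure that \<open>J\<^sup>#\<close> inherits as right adjoint of the strong morphism \<open>J\<^sup>*\<close>. The arrow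
\<open>\<gamma>~\<^sub>B\<^sub>C\<close> of the induced structure is the case \<open>X = J\<^sup># C\<close>. The laws below involve the objects \<open>X \<otimes> Y\<close>
and \<open>I\<close>, which need not be values of \<open>J\<^sup>#\<close>, hence a general \<open>X\<close>.\<close>

definition strength where
  "strength B X = transpose V Ja \<eta> (Jo B \<otimes>\<^bsub>V\<^esub> X) ((\<epsilon> B \<ltimes> X) \<bullet> inv_arr \<A> (\<mu> J (Jo B) X))"

lemma strength_simps [simp]:
  assumes "B \<in> Obj \<A>" "X \<in> Obj V"
  shows "strength B X \<in> Arr V" "Dom V (strength B X) = Jo B \<otimes>\<^bsub>V\<^esub> X"
    "Cod V (strength B X) = Jo (B \<star> X)"
  using assms by (simp_all add: strength_def transpose_def)

text \<open>The strength is the unique arrow with this property; it is used in place of the definition.\<close>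

lemma counit_strength:
  assumes "B \<in> Obj \<A>" "X \<in> Obj V"
  shows "\<epsilon> (B \<star> X) \<bullet> (J \<rtimes> strength B X) \<bullet> \<mu> J (Jo B) X = \<epsilon> B \<ltimes> X"
proof -
  have *: "\<epsilon> (B \<star> X) \<bullet> (J \<rtimes> strength B X) = (\<epsilon> B \<ltimes> X) \<bullet> inv_arr \<A> (\<mu> J (Jo B) X)"
    unfolding strength_def using assms by (intro counit_transpose) simp_all
  show ?thesis
    using assms by (simp add: A.rewrite2[OF *])
qed

lemma strength_natural:
  assumes [simp]: "f \<in> Arr \<A>" "k \<in> Arr V" and [simp]: "Cod \<A> f = B" "Cod V k = X"
  shows "strength B X \<bullet>\<^sub>V (Ja f \<boxtimes>\<^bsub>V\<^esub> k) = Ja (f \<circledast> k) \<bullet>\<^sub>V strength (Dom \<A> f) (Dom V k)"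
proof -
  have [simp]: "B \<in> Obj \<A>" "X \<in> Obj V"
    using A.cod_obj[OF assms(1)] V.cod_obj[OF assms(2)] by simp_all
  let ?B = "Dom \<A> f" and ?X = "Dom V k"
  have "\<epsilon> (B \<star> X) \<bullet> (J \<rtimes> (strength B X \<bullet>\<^sub>V (Ja f \<boxtimes>\<^bsub>V\<^esub> k)))
      = \<epsilon> (B \<star> X) \<bullet> (J \<rtimes> (Ja (f \<circledast> k) \<bullet>\<^sub>V strength ?B ?X))"
  proof (rule A.iso_cancel_right)
    have "(\<epsilon> (B \<star> X) \<bullet> (J \<rtimes> (strength B X \<bullet>\<^sub>V (Ja f \<boxtimes>\<^bsub>V\<^esub> k)))) \<bullet> \<mu> J (Jo ?B) ?X
        = \<epsilon> (B \<star> X) \<bullet> (J \<rtimes> strength B X) \<bullet> \<mu> J (Jo B) X \<bullet> ((J \<rtimes> Ja f) \<circledast> k)"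
      by (simp add: lwhisker_comp mult_natural)
    also have "\<dots> = (\<epsilon> B \<ltimes> X) \<bullet> ((J \<rtimes> Ja f) \<circledast> k)"
      by (simp add: A.rewrite3[OF counit_strength])
    also have "\<dots> = (\<epsilon> B \<bullet> (J \<rtimes> Ja f)) \<circledast> k"
      using act_comp[of "J \<rtimes> Ja f" "\<epsilon> B" k "\<one>\<^bsub>V\<^esub> X"] by simp
    also have "\<dots> = (f \<bullet> \<epsilon> ?B) \<circledast> k"
      by (simp add: counit_natural)
    also have "\<dots> = (f \<circledast> k) \<bullet> (\<epsilon> ?B \<ltimes> ?X)"
      using act_comp[of "\<epsilon> ?B" f "\<one>\<^bsub>V\<^esub> ?X" k] by simp
    also have "\<dots> = (f \<circledast> k) \<bullet> \<epsilon> (?B \<star> ?X) \<bullet> (J \<rtimes> strength ?B ?X) \<bullet> \<mu> J (Jo ?B) ?X"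
      by (simp add: counit_strength)
    also have "\<dots> = (\<epsilon> (B \<star> X) \<bullet> (J \<rtimes> (Ja (f \<circledast> k) \<bullet>\<^sub>V strength ?B ?X))) \<bullet> \<mu> J (Jo ?B) ?X"
      by (simp add: lwhisker_comp A.rewrite2[OF counit_natural])
    finally show "(\<epsilon> (B \<star> X) \<bullet> (J \<rtimes> (strength B X \<bullet>\<^sub>V (Ja f \<boxtimes>\<^bsub>V\<^esub> k)))) \<bullet> \<mu> J (Jo ?B) ?X
      = (\<epsilon> (B \<star> X) \<bullet> (J \<rtimes> (Ja (f \<circledast> k) \<bullet>\<^sub>V strength ?B ?X))) \<bullet> \<mu> J (Jo ?B) ?X" .
  qed simp_all
  then show ?thesis
    by (intro counit_eqI[where A = "B \<star> X"]) simp_all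
qed

lemma strength_natural_right:
  assumes "B \<in> Obj \<A>" "k \<in> Arr V" "Cod V k = X"
  shows "strength B X \<bullet>\<^sub>V (\<one>\<^bsub>V\<^esub> (Jo B) \<boxtimes>\<^bsub>V\<^esub> k) = Ja (B \<rtimes> k) \<bullet>\<^sub>V strength B (Dom V k)"
  using strength_natural[of "\<one>\<^bsub>\<A>\<^esub> B" k B X] assms by simp

text \<open>After transposing and composing with the multiplications of \<open>J\<close>, all strengths are absorbed by the
counit, and what is left is naturality of \<open>\<mu>\<close> in \<open>\<epsilon> B\<close>.\<close>

lemma strength_assoc:
  assumes [simp]: "B \<in> Obj \<A>" "X \<in> Obj V" "Y \<in> Obj V"
  shows "Ja (\<mu> B X Y) \<bullet>\<^sub>V strength (B \<star> X) Y \<bullet>\<^sub>V (strength B X \<boxtimes>\<^bsub>V\<^esub> \<one>\<^bsub>V\<^esub> Y)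
    = strength B (X \<otimes>\<^bsub>V\<^esub> Y) \<bullet>\<^sub>V Assoc V (Jo B) X Y"
proof (rule counit_eqI[where A = "B \<star> (X \<otimes>\<^bsub>V\<^esub> Y)"])
  let ?L = "\<epsilon> (B \<star> (X \<otimes>\<^bsub>V\<^esub> Y)) \<bullet>
    (J \<rtimes> (Ja (\<mu> B X Y) \<bullet>\<^sub>V strength (B \<star> X) Y \<bullet>\<^sub>V (strength B X \<boxtimes>\<^bsub>V\<^esub> \<one>\<^bsub>V\<^esub> Y)))"
  let ?R = "\<epsilon> (B \<star> (X \<otimes>\<^bsub>V\<^esub> Y)) \<bullet> (J \<rtimes> (strength B (X \<otimes>\<^bsub>V\<^esub> Y) \<bullet>\<^sub>V Assoc V (Jo B) X Y))"
  let ?m = "\<mu> J (Jo B \<otimes>\<^bsub>V\<^esub> X) Y" and ?n = "\<mu> J (Jo B) X \<ltimes> Y"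
  show "?L = ?R"
  proof (rule A.iso_cancel_right)
    have "?L \<bullet> ?m \<bullet> ?n = \<mu> B X Y \<bullet> \<epsilon> ((B \<star> X) \<star> Y) \<bullet> (J \<rtimes> strength (B \<star> X) Y)
        \<bullet> \<mu> J (Jo (B \<star> X)) Y \<bullet> ((J \<rtimes> strength B X) \<ltimes> Y) \<bullet> ?n"
      by (simp add: lwhisker_comp A.rewrite2[OF counit_natural] A.rewrite2[OF mult_natural_inner])
    also have "\<dots> = \<mu> B X Y \<bullet> (\<epsilon> (B \<star> X) \<ltimes> Y) \<bullet> ((J \<rtimes> strength B X) \<ltimes> Y) \<bullet> ?n"
      by (simp add: A.rewrite3[OF counit_strength])
    also have "\<dots> = \<mu> B X Y \<bullet> ((\<epsilon> B \<ltimes> X) \<ltimes> Y)"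
      by (simp add: counit_strength flip: rwhisker_comp)
    also have "\<dots> = (\<epsilon> B \<ltimes> (X \<otimes>\<^bsub>V\<^esub> Y)) \<bullet> \<mu> (J \<star> Jo B) X Y"
      by (simp add: mult_natural_rwhisker)
    also have "\<dots> = \<epsilon> (B \<star> (X \<otimes>\<^bsub>V\<^esub> Y)) \<bullet> (J \<rtimes> strength B (X \<otimes>\<^bsub>V\<^esub> Y))
        \<bullet> \<mu> J (Jo B) (X \<otimes>\<^bsub>V\<^esub> Y) \<bullet> \<mu> (J \<star> Jo B) X Y"
      by (simp add: A.rewrite3[OF counit_strength])
    also have "\<dots> = ?R \<bullet> ?m \<bullet> ?n"
      by (simp add: lwhisker_comp act_pentagon)
    finally show "?L \<bullet> ?m \<bullet> ?n = ?R \<bullet> ?m \<bullet> ?n" .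
  qed simp_all
qed simp_all

lemma strength_unit:
  assumes [simp]: "B \<in> Obj \<A>"
  shows "strength B (Unit V) \<bullet>\<^sub>V RUnit V (Jo B) = Ja (ActUnit T B)"
proof (rule counit_eqI)
  have "\<epsilon> (B \<star> Unit V) \<bullet> (J \<rtimes> (strength B (Unit V) \<bullet>\<^sub>V RUnit V (Jo B)))
      = \<epsilon> (B \<star> Unit V) \<bullet> (J \<rtimes> strength B (Unit V)) \<bullet> \<mu> J (Jo B) (Unit V) \<bullet> ActUnit T (J \<star> Jo B)"
    by (simp add: lwhisker_comp act_runit)
  also have "\<dots> = (\<epsilon> B \<ltimes> Unit V) \<bullet> ActUnit T (J \<star> Jo B)"
    by (simp add: A.rewrite3[OF counit_strength])
  also have "\<dots> = \<epsilon> (B \<star> Unit V) \<bullet> (J \<rtimes> Ja (ActUnit T B))"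
    by (simp add: counit_natural act_unit_natural)
  finally show "\<epsilon> (B \<star> Unit V) \<bullet> (J \<rtimes> (strength B (Unit V) \<bullet>\<^sub>V RUnit V (Jo B)))
    = \<epsilon> (B \<star> Unit V) \<bullet> (J \<rtimes> Ja (ActUnit T B))" .
qed simp_all

text \<open>The transpose \<open>I \<rightarrow> J\<^sup># J\<close> of \<open>u\<^sub>J\<^sup>-\<^sup>1 : J * I \<rightarrow> J\<close>, in terms of which \<open>\<rho>\<^sub>A\<close> is \<open>A \<rtimes> unit_point\<close> after \<open>u\<^sub>A\<close>.\<close>

definition unit_point where
  "unit_point = Ja (inv_arr \<A> (ActUnit T J)) \<bullet>\<^sub>V \<eta> (Unit V)"

lemma unit_point_simps [simp]:
  "unit_point \<in> Arr V" "Dom V unit_point = Unit V" "Cod V unit_point = Jo J"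
  by (simp_all add: unit_point_def)

lemma counit_unit_point: "\<epsilon> J \<bullet> (J \<rtimes> unit_point) = inv_arr \<A> (ActUnit T J)"
  using counit_transpose[of "inv_arr \<A> (ActUnit T J)" "Unit V" J]
  by (simp add: unit_point_def transpose_def)

text \<open>Inserting the point of \<open>J\<^sup># J\<close>, applying the strength and evaluating by the counit is the left unit
constraint. This carries the skew triangle; under transposition it is the left unit law of the
action at \<open>J\<close>.\<close>

lemma strength_unit_point:
  assumes [simp]: "B \<in> Obj \<A>"
  shows "Ja (\<epsilon> B) \<bullet>\<^sub>V strength J (Jo B) \<bullet>\<^sub>V (unit_point \<boxtimes>\<^bsub>V\<^esub> \<one>\<^bsub>V\<^esub> (Jo B)) = LUnit V (Jo B)"
proof (rule counit_eqI)
  let ?L = "\<epsilon> B \<bullet>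
    (J \<rtimes> (Ja (\<epsilon> B) \<bullet>\<^sub>V strength J (Jo B) \<bullet>\<^sub>V (unit_point \<boxtimes>\<^bsub>V\<^esub> \<one>\<^bsub>V\<^esub> (Jo B))))"
  let ?m = "\<mu> J (Unit V) (Jo B)" and ?u = "ActUnit T J \<ltimes> Jo B"
  show "?L = \<epsilon> B \<bullet> (J \<rtimes> LUnit V (Jo B))"
  proof (rule A.iso_cancel_right)
    have "?L \<bullet> ?m \<bullet> ?u = \<epsilon> B \<bullet> \<epsilon> (J \<star> Jo B) \<bullet> (J \<rtimes> strength J (Jo B))
        \<bullet> \<mu> J (Jo J) (Jo B) \<bullet> ((J \<rtimes> unit_point) \<ltimes> Jo B) \<bullet> ?u"
      by (simp add: lwhisker_comp A.rewrite2[OF counit_natural] A.rewrite2[OF mult_natural_inner])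
    also have "\<dots> = \<epsilon> B \<bullet> (\<epsilon> J \<ltimes> Jo B) \<bullet> ((J \<rtimes> unit_point) \<ltimes> Jo B) \<bullet> ?u"
      by (simp add: A.rewrite3[OF counit_strength])
    also have "\<dots> = \<epsilon> B \<bullet> ((\<epsilon> J \<bullet> (J \<rtimes> unit_point) \<bullet> ActUnit T J) \<ltimes> Jo B)"
      by (simp add: rwhisker_comp)
    also have "\<dots> = \<epsilon> B"
      by (simp add: A.rewrite2[OF counit_unit_point] act_ide)
    also have "\<dots> = (\<epsilon> B \<bullet> (J \<rtimes> LUnit V (Jo B))) \<bullet> ?m \<bullet> ?u"
      by (simp add: act_lunit)
    finally show "?L \<bullet> ?m \<bullet> ?u = (\<epsilon> B \<bullet> (J \<rtimes> LUnit V (Jo B))) \<bullet> ?m \<bullet> ?u" .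
  qed simp_all
qed simp_all

section \<open>The induced left skew monoidal structure\<close>

abbreviation S where "S \<equiv> induced_skew V \<A> T J Jo Ja \<eta> \<epsilon>"

lemma induced_skew_simps [simp]:
  "Obj S = Obj \<A>" "Arr S = Arr \<A>" "Dom S = Dom \<A>" "Cod S = Cod \<A>" "Ide S = Ide \<A>"
  "Comp S = Comp \<A>" "A \<otimes>\<^bsub>S\<^esub> B = A \<star> Jo B" "f \<boxtimes>\<^bsub>S\<^esub> g = f \<circledast> Ja g" "Unit S = J"
  "LUnit S = \<epsilon>" "Hom S A B = Hom \<A> A B"
  by (simp_all add: induced_skew_def Hom_def)

lemma induced_assoc: "Assoc S A B C = (A \<rtimes> strength B (Jo C)) \<bullet> \<mu> A (Jo B) (Jo C)"
  by (simp add: induced_skew_def strength_def induced_mult_def)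

lemma induced_runit:
  "A \<in> Obj \<A> \<Longrightarrow> RUnit S A = (A \<rtimes> unit_point) \<bullet> ActUnit T A"
  by (simp add: induced_skew_def unit_point_def lwhisker_comp)

lemma induced_assoc_simps [simp]:
  assumes "A \<in> Obj \<A>" "B \<in> Obj \<A>" "C \<in> Obj \<A>"
  shows "Assoc S A B C \<in> Arr \<A>" "Dom \<A> (Assoc S A B C) = (A \<star> Jo B) \<star> Jo C"
    "Cod \<A> (Assoc S A B C) = A \<star> Jo (B \<star> Jo C)"
  using assms by (simp_all add: induced_assoc)

lemma induced_runit_simps [simp]:
  assumes "A \<in> Obj \<A>"
  shows "RUnit S A \<in> Arr \<A>" "Dom \<A> (RUnit S A) = A" "Cod \<A> (RUnit S A) = A \<star> Jo J"
  using assms by (simp_all add: induced_runit)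

lemma induced_category: "category S"
  by unfold_locales (simp_all add: A.id_hom A.comp_hom A.id_left A.id_right A.comp_assoc)

lemma induced_tensor_category: "tensor_category S"
proof -
  have "is_functor (S \<times>\<^sub>C S) S (\<lambda>(X, Y). X \<otimes>\<^bsub>S\<^esub> Y) (\<lambda>(f, g). f \<boxtimes>\<^bsub>S\<^esub> g)"
    by (rule is_functorI; (intro category_prod_cat induced_category)?;
        clarsimp simp: act_ide act_comp Ja_comp)
  then show ?thesis
    by (simp add: tensor_category_def tensor_category_axioms_def induced_category)
qed

lemma induced_assoc_natural:
  assumes [simp]: "f \<in> Arr \<A>" "g \<in> Arr \<A>" "h \<in> Arr \<A>"
  shows "(f \<circledast> Ja (g \<circledast> Ja h)) \<bullet> Assoc S (Dom \<A> f) (Dom \<A> g) (Dom \<A> h)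
    = Assoc S (Cod \<A> f) (Cod \<A> g) (Cod \<A> h) \<bullet> ((f \<circledast> Ja g) \<circledast> Ja h)"
proof -
  let ?s = "strength (Dom \<A> g) (Jo (Dom \<A> h))" and ?t = "strength (Cod \<A> g) (Jo (Cod \<A> h))"
  let ?m = "\<mu> (Dom \<A> f) (Jo (Dom \<A> g)) (Jo (Dom \<A> h))"
  have "(f \<circledast> Ja (g \<circledast> Ja h)) \<bullet> Assoc S (Dom \<A> f) (Dom \<A> g) (Dom \<A> h)
      = (f \<circledast> (Ja (g \<circledast> Ja h) \<bullet>\<^sub>V ?s)) \<bullet> ?m"
    using act_comp[of "\<one>\<^bsub>\<A>\<^esub> (Dom \<A> f)" f ?s "Ja (g \<circledast> Ja h)"] by (simp add: induced_assoc)
  also have "\<dots> = (f \<circledast> (?t \<bullet>\<^sub>V (Ja g \<boxtimes>\<^bsub>V\<^esub> Ja h))) \<bullet> ?m"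
    by (simp add: strength_natural)
  also have "\<dots> = Assoc S (Cod \<A> f) (Cod \<A> g) (Cod \<A> h) \<bullet> ((f \<circledast> Ja g) \<circledast> Ja h)"
    using act_comp[of f "\<one>\<^bsub>\<A>\<^esub> (Cod \<A> f)" "Ja g \<boxtimes>\<^bsub>V\<^esub> Ja h" ?t]
    by (simp add: induced_assoc mult_natural)
  finally show ?thesis .
qed

lemma induced_runit_natural:
  assumes [simp]: "f \<in> Arr \<A>"
  shows "(f \<ltimes> Jo J) \<bullet> RUnit S (Dom \<A> f) = RUnit S (Cod \<A> f) \<bullet> f"
  by (simp add: induced_runit act_unit_natural
      A.rewrite2[OF whisker_exchange[where f = f and k = unit_point]])

text \<open>Naturality of \<open>\<mu>\<close> collects all strengths on one side of the multiplications. There \<open>strength_assoc\<close>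
trades the two nested strengths for one strength and an associator of \<open>V\<close>, which the pentagon of
the action absorbs.\<close>

lemma induced_pentagon:
  assumes [simp]: "A \<in> Obj \<A>" "B \<in> Obj \<A>" "C \<in> Obj \<A>" "D \<in> Obj \<A>"
  shows "(A \<rtimes> Ja (Assoc S B C D)) \<bullet> Assoc S A (B \<star> Jo C) D \<bullet> (Assoc S A B C \<ltimes> Jo D)
    = Assoc S A B (C \<star> Jo D) \<bullet> Assoc S (A \<star> Jo B) C D"
proof -
  let ?b = "Jo B" and ?c = "Jo C" and ?d = "Jo D"
  let ?m = "\<mu> A (?b \<otimes>\<^bsub>V\<^esub> ?c) ?d \<bullet> (\<mu> A ?b ?c \<ltimes> ?d)"
  have "(A \<rtimes> Ja (Assoc S B C D)) \<bullet> Assoc S A (B \<star> Jo C) D \<bullet> (Assoc S A B C \<ltimes> Jo D)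
      = (A \<rtimes> Ja (B \<rtimes> strength C ?d)) \<bullet> (A \<rtimes> (Ja (\<mu> B ?c ?d) \<bullet>\<^sub>V strength (B \<star> ?c) ?d
          \<bullet>\<^sub>V (strength B ?c \<boxtimes>\<^bsub>V\<^esub> \<one>\<^bsub>V\<^esub> ?d))) \<bullet> ?m"
    by (simp add: induced_assoc Ja_comp lwhisker_comp rwhisker_comp A.rewrite2[OF mult_natural_inner])
  also have "\<dots> = (A \<rtimes> (Ja (B \<rtimes> strength C ?d) \<bullet>\<^sub>V strength B (?c \<otimes>\<^bsub>V\<^esub> ?d))) \<bullet>
      (A \<rtimes> Assoc V ?b ?c ?d) \<bullet> ?m"
    by (simp add: strength_assoc lwhisker_comp)
  also have "\<dots> = (A \<rtimes> (strength B (Jo (C \<star> ?d)) \<bullet>\<^sub>V (\<one>\<^bsub>V\<^esub> ?b \<boxtimes>\<^bsub>V\<^esub> strength C ?d)))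
      \<bullet> \<mu> A ?b (?c \<otimes>\<^bsub>V\<^esub> ?d) \<bullet> \<mu> (A \<star> ?b) ?c ?d"
    by (simp add: strength_natural_right act_pentagon)
  also have "\<dots> = Assoc S A B (C \<star> Jo D) \<bullet> Assoc S (A \<star> Jo B) C D"
    by (simp add: induced_assoc lwhisker_comp A.rewrite2[OF mult_natural_outer])
  finally show ?thesis .
qed

lemma induced_assoc_runit:
  assumes [simp]: "A \<in> Obj \<A>" "B \<in> Obj \<A>"
  shows "Assoc S A B J \<bullet> RUnit S (A \<star> Jo B) = A \<rtimes> Ja (RUnit S B)"
proof -
  have "Assoc S A B J \<bullet> RUnit S (A \<star> Jo B)
      = (A \<rtimes> (strength B (Jo J) \<bullet>\<^sub>V (\<one>\<^bsub>V\<^esub> (Jo B) \<boxtimes>\<^bsub>V\<^esub> unit_point))) \<bullet>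
        \<mu> A (Jo B) (Unit V) \<bullet> ActUnit T (A \<star> Jo B)"
    by (simp add: induced_assoc induced_runit A.rewrite2[OF mult_natural_outer] lwhisker_comp)
  also have "\<dots> = A \<rtimes> (Ja (B \<rtimes> unit_point) \<bullet>\<^sub>V strength B (Unit V) \<bullet>\<^sub>V RUnit V (Jo B))"
    by (simp add: act_runit strength_natural_right lwhisker_comp)
  also have "\<dots> = A \<rtimes> Ja (RUnit S B)"
    by (simp add: strength_unit induced_runit Ja_comp)
  finally show ?thesis .
qed

lemma induced_triangle:
  assumes [simp]: "A \<in> Obj \<A>" "B \<in> Obj \<A>"
  shows "(A \<rtimes> Ja (\<epsilon> B)) \<bullet> Assoc S A J B \<bullet> (RUnit S A \<ltimes> Jo B) = \<one>\<^bsub>\<A>\<^esub> (A \<star> Jo B)"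
proof -
  have "(A \<rtimes> Ja (\<epsilon> B)) \<bullet> Assoc S A J B \<bullet> (RUnit S A \<ltimes> Jo B)
      = (A \<rtimes> (Ja (\<epsilon> B) \<bullet>\<^sub>V strength J (Jo B) \<bullet>\<^sub>V (unit_point \<boxtimes>\<^bsub>V\<^esub> \<one>\<^bsub>V\<^esub> (Jo B))))
        \<bullet> \<mu> A (Unit V) (Jo B) \<bullet> (ActUnit T A \<ltimes> Jo B)"
    by (simp add: induced_assoc induced_runit rwhisker_comp lwhisker_comp
        A.rewrite2[OF mult_natural_inner])
  then show ?thesis by (simp add: strength_unit_point act_lunit)
qed

theorem induced_left_skew_monoidal: "left_skew_monoidal_category S"
proof -
  interpret S: tensor_category S by (rule induced_tensor_category)
  have "nat_trans (S \<times>\<^sub>C S \<times>\<^sub>C S) S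
      (\<lambda>((X, Y), Z). (X \<otimes>\<^bsub>S\<^esub> Y) \<otimes>\<^bsub>S\<^esub> Z) (\<lambda>((f, g), h). (f \<boxtimes>\<^bsub>S\<^esub> g) \<boxtimes>\<^bsub>S\<^esub> h)
      (\<lambda>((X, Y), Z). X \<otimes>\<^bsub>S\<^esub> (Y \<otimes>\<^bsub>S\<^esub> Z)) (\<lambda>((f, g), h). f \<boxtimes>\<^bsub>S\<^esub> (g \<boxtimes>\<^bsub>S\<^esub> h))
      (\<lambda>((X, Y), Z). Assoc S X Y Z)"
    by (rule nat_transI[OF S.tensor_triple_functors(1,2)])
      (clarsimp simp: induced_assoc_natural)+
  moreover have "nat_trans S S (\<lambda>X. Unit S \<otimes>\<^bsub>S\<^esub> X) (\<lambda>f. \<one>\<^bsub>S\<^esub> (Unit S) \<boxtimes>\<^bsub>S\<^esub> f)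
      (\<lambda>X. X) (\<lambda>f. f) (LUnit S)"
    by (rule nat_transI[OF S.tensor_unit_functors(2,1)]) (simp_all add: counit_natural)
  moreover have "nat_trans S S (\<lambda>X. X) (\<lambda>f. f)
      (\<lambda>X. X \<otimes>\<^bsub>S\<^esub> Unit S) (\<lambda>f. f \<boxtimes>\<^bsub>S\<^esub> \<one>\<^bsub>S\<^esub> (Unit S)) (RUnit S)"
    by (rule nat_transI[OF S.tensor_unit_functors(1,3)]) (simp_all add: induced_runit_natural)
  moreover have "\<epsilon> (A \<star> Jo B) \<bullet> Assoc S J A B = \<epsilon> A \<ltimes> Jo B"
    if "A \<in> Obj \<A>" "B \<in> Obj \<A>" for A B
    using that by (simp add: induced_assoc counit_strength)
  moreover have "\<epsilon> J \<bullet> RUnit S J = \<one>\<^bsub>\<A>\<^esub> J"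
    by (simp add: induced_runit A.rewrite2[OF counit_unit_point])
  ultimately show ?thesis
    by (intro left_skew_monoidal_category.intro left_skew_monoidal_category_axioms.intro
        S.tensor_category_axioms)
      (simp_all add: induced_pentagon induced_assoc_runit induced_triangle)
qed

end

section \<open>The induced right braiding\<close>

locale braided_actegory_right_adjoint =
  actegory_right_adjoint V \<A> T J Jo Ja \<eta> \<epsilon> + braided_actegory V \<A> T c
  for V :: "('x, 'g, 'z) tensor_cat_scheme" and \<A> :: "('a, 'f, 'y) cat_scheme"
    and T :: "('a, 'f, 'x, 'g) action" (structure)
    and J Jo Ja \<eta> \<epsilon> c
begin

abbreviation s where "s \<equiv> induced_braiding \<A> T c Jo"

lemma induced_braiding_eq: "s P A B = \<sigma> P (Jo A) (Jo B)"
  by (simp add: induced_braiding_def \<sigma>_def)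

lemma strength_assoc_whiskered:
  assumes [simp]: "P \<in> Obj \<A>" "A \<in> Obj \<A>" "X \<in> Obj V" "Y \<in> Obj V"
  shows "(P \<rtimes> Ja (\<mu> A X Y)) \<bullet> (P \<rtimes> strength (A \<star> X) Y) \<bullet> \<mu> P (Jo (A \<star> X)) Y
      \<bullet> ((P \<rtimes> strength A X) \<ltimes> Y) \<bullet> (\<mu> P (Jo A) X \<ltimes> Y)
    = (P \<rtimes> strength A (X \<otimes>\<^bsub>V\<^esub> Y)) \<bullet> \<mu> P (Jo A) (X \<otimes>\<^bsub>V\<^esub> Y) \<bullet> \<mu> (P \<star> Jo A) X Y"
proof -
  let ?m = "\<mu> P (Jo A \<otimes>\<^bsub>V\<^esub> X) Y \<bullet> (\<mu> P (Jo A) X \<ltimes> Y)"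
  have "(P \<rtimes> Ja (\<mu> A X Y)) \<bullet> (P \<rtimes> strength (A \<star> X) Y) \<bullet> \<mu> P (Jo (A \<star> X)) Y
      \<bullet> ((P \<rtimes> strength A X) \<ltimes> Y) \<bullet> (\<mu> P (Jo A) X \<ltimes> Y)
    = (P \<rtimes> (Ja (\<mu> A X Y) \<bullet>\<^sub>V strength (A \<star> X) Y \<bullet>\<^sub>V (strength A X \<boxtimes>\<^bsub>V\<^esub> \<one>\<^bsub>V\<^esub> Y))) \<bullet> ?m"
    by (simp add: lwhisker_comp A.rewrite2[OF mult_natural_inner])
  also have "\<dots> = (P \<rtimes> strength A (X \<otimes>\<^bsub>V\<^esub> Y)) \<bullet> (P \<rtimes> Assoc V (Jo A) X Y) \<bullet> ?m"
    by (simp add: strength_assoc lwhisker_comp)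
  finally show ?thesis by (simp add: act_pentagon)
qed

text \<open>On the left, \<open>strength_assoc\<close> merges the strengths along \<open>Y\<close> and \<open>Z\<close> into one along \<open>Y \<otimes> Z\<close>, up to
\<open>J\<^sup># \<mu>\<close>. Now \<open>\<mu>\<close> turns \<open>\<sigma>\<close> into \<open>A \<rtimes> c Y Z\<close>, the merged strength is natural in \<open>c Y Z\<close>, and splitting the
resulting strength along \<open>Z \<otimes> Y\<close> again gives the right side.\<close>

lemma \<sigma>_strength:
  assumes [simp]: "P \<in> Obj \<A>" "A \<in> Obj \<A>" "Y \<in> Obj V" "Z \<in> Obj V"
  shows "(P \<rtimes> Ja (\<sigma> A Y Z)) \<bullet> (P \<rtimes> strength (A \<star> Y) Z) \<bullet> \<mu> P (Jo (A \<star> Y)) Z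
      \<bullet> ((P \<rtimes> strength A Y) \<ltimes> Z) \<bullet> (\<mu> P (Jo A) Y \<ltimes> Z)
    = (P \<rtimes> strength (A \<star> Z) Y) \<bullet> \<mu> P (Jo (A \<star> Z)) Y
      \<bullet> ((P \<rtimes> strength A Z) \<ltimes> Y) \<bullet> (\<mu> P (Jo A) Z \<ltimes> Y) \<bullet> \<sigma> (P \<star> Jo A) Y Z"
    (is "(P \<rtimes> Ja (\<sigma> A Y Z)) \<bullet> ?L = ?R")
proof (rule A.iso_cancel_left)
  let ?h = "P \<rtimes> Ja (\<mu> A Z Y)"
  have "iso_arr V (Ja (\<mu> A Z Y))"
    by (intro V.iso_arrI[of _ "Ja (inv_arr \<A> (\<mu> A Z Y))"]) (simp_all flip: Ja_comp)
  then show "iso_arr \<A> ?h" by simp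
  have "?h \<bullet> (P \<rtimes> Ja (\<sigma> A Y Z)) \<bullet> ?L = (P \<rtimes> Ja (\<mu> A Z Y \<bullet> \<sigma> A Y Z)) \<bullet> ?L"
    by (simp add: Ja_comp lwhisker_comp)
  also have "\<dots> = (P \<rtimes> Ja (A \<rtimes> c Y Z)) \<bullet> (P \<rtimes> Ja (\<mu> A Y Z)) \<bullet> ?L"
    by (simp add: mult_\<sigma> Ja_comp lwhisker_comp)
  also have "\<dots> = (P \<rtimes> (Ja (A \<rtimes> c Y Z) \<bullet>\<^sub>V strength A (Y \<otimes>\<^bsub>V\<^esub> Z))) \<bullet> \<mu> P (Jo A) (Y \<otimes>\<^bsub>V\<^esub> Z)
      \<bullet> \<mu> (P \<star> Jo A) Y Z"
    by (simp add: strength_assoc_whiskered lwhisker_comp)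
  also have "\<dots> = (P \<rtimes> (strength A (Z \<otimes>\<^bsub>V\<^esub> Y) \<bullet>\<^sub>V (\<one>\<^bsub>V\<^esub> (Jo A) \<boxtimes>\<^bsub>V\<^esub> c Y Z)))
      \<bullet> \<mu> P (Jo A) (Y \<otimes>\<^bsub>V\<^esub> Z) \<bullet> \<mu> (P \<star> Jo A) Y Z"
    by (simp add: strength_natural_right)
  also have "\<dots> = (P \<rtimes> strength A (Z \<otimes>\<^bsub>V\<^esub> Y)) \<bullet> \<mu> P (Jo A) (Z \<otimes>\<^bsub>V\<^esub> Y)
      \<bullet> ((P \<star> Jo A) \<rtimes> c Y Z) \<bullet> \<mu> (P \<star> Jo A) Y Z"
    by (simp add: lwhisker_comp A.rewrite2[OF mult_natural_outer])
  also have "\<dots> = (P \<rtimes> strength A (Z \<otimes>\<^bsub>V\<^esub> Y)) \<bullet> \<mu> P (Jo A) (Z \<otimes>\<^bsub>V\<^esub> Y)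
      \<bullet> \<mu> (P \<star> Jo A) Z Y \<bullet> \<sigma> (P \<star> Jo A) Y Z"
    by (simp add: mult_\<sigma>)
  \<comment> \<open>Bracketed so that the three leading factors form one side of \<open>strength_assoc_whiskered\<close>.\<close>
  also have "\<dots> = ((P \<rtimes> strength A (Z \<otimes>\<^bsub>V\<^esub> Y)) \<bullet> \<mu> P (Jo A) (Z \<otimes>\<^bsub>V\<^esub> Y)
      \<bullet> \<mu> (P \<star> Jo A) Z Y) \<bullet> \<sigma> (P \<star> Jo A) Y Z"
    by simp
  also have "\<dots> = ?h \<bullet> ?R"
    by (simp flip: strength_assoc_whiskered)
  finally show "?h \<bullet> (P \<rtimes> Ja (\<sigma> A Y Z)) \<bullet> ?L = ?h \<bullet> ?R" .
qed simp_all

theorem induced_right_braiding: "right_braiding S s"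
proof -
  interpret S: left_skew_monoidal_category S by (rule induced_left_skew_monoidal)
  have "nat_trans (S \<times>\<^sub>C S \<times>\<^sub>C S) S
      (\<lambda>((P, X), Y). (P \<otimes>\<^bsub>S\<^esub> X) \<otimes>\<^bsub>S\<^esub> Y) (\<lambda>((p, f), g). (p \<boxtimes>\<^bsub>S\<^esub> f) \<boxtimes>\<^bsub>S\<^esub> g)
      (\<lambda>((P, X), Y). (P \<otimes>\<^bsub>S\<^esub> Y) \<otimes>\<^bsub>S\<^esub> X) (\<lambda>((p, f), g). (p \<boxtimes>\<^bsub>S\<^esub> g) \<boxtimes>\<^bsub>S\<^esub> f)
      (\<lambda>((P, X), Y). s P X Y)"
  proof (rule nat_transI[OF S.tensor_triple_functors(1,3)]; clarsimp simp: induced_braiding_eq)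
    fix p f g assume [simp]: "p \<in> Arr \<A>" "f \<in> Arr \<A>" "g \<in> Arr \<A>"
    show "((p \<circledast> Ja g) \<circledast> Ja f) \<bullet> \<sigma> (Dom \<A> p) (Jo (Dom \<A> f)) (Jo (Dom \<A> g))
        = \<sigma> (Cod \<A> p) (Jo (Cod \<A> f)) (Jo (Cod \<A> g)) \<bullet> ((p \<circledast> Ja f) \<circledast> Ja g)"
      using \<sigma>_natural[of p "Ja f" "Ja g"] by simp
  qed
  then have "nat_iso (S \<times>\<^sub>C S \<times>\<^sub>C S) S
      (\<lambda>((P, X), Y). (P \<otimes>\<^bsub>S\<^esub> X) \<otimes>\<^bsub>S\<^esub> Y) (\<lambda>((p, f), g). (p \<boxtimes>\<^bsub>S\<^esub> f) \<boxtimes>\<^bsub>S\<^esub> g)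
      (\<lambda>((P, X), Y). (P \<otimes>\<^bsub>S\<^esub> Y) \<otimes>\<^bsub>S\<^esub> X) (\<lambda>((p, f), g). (p \<boxtimes>\<^bsub>S\<^esub> g) \<boxtimes>\<^bsub>S\<^esub> f)
      (\<lambda>((P, X), Y). s P X Y)"
  proof (rule nat_iso.intro, intro nat_iso_axioms.intro, clarsimp)
    fix P X Y assume "P \<in> Obj \<A>" "X \<in> Obj \<A>" "Y \<in> Obj \<A>"
    then have "iso_arr \<A> (s P X Y)" by (simp add: induced_braiding_eq)
    then show "iso_arr S (s P X Y)" by (simp add: iso_arr_def inverse_arrows_def)
  qed
  moreover have "(Assoc S P Y Z \<ltimes> Jo X) \<bullet> s (P \<star> Jo Y) X Z \<bullet> (s P X Y \<ltimes> Jo Z)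
      = s P X (Y \<star> Jo Z) \<bullet> Assoc S (P \<star> Jo X) Y Z"
    if "P \<in> Obj \<A>" "X \<in> Obj \<A>" "Y \<in> Obj \<A>" "Z \<in> Obj \<A>" for P X Y Z
    using that by (simp add: induced_braiding_eq induced_assoc rwhisker_comp \<sigma>_tensor_right
        A.rewrite2[OF \<sigma>_natural_outer])
  moreover have "Assoc S (P \<star> Jo Z) X Y \<bullet> (s P X Z \<ltimes> Jo Y) \<bullet> s (P \<star> Jo X) Y Z
      = s P (X \<star> Jo Y) Z \<bullet> (Assoc S P X Y \<ltimes> Jo Z)"
    if "P \<in> Obj \<A>" "X \<in> Obj \<A>" "Y \<in> Obj \<A>" "Z \<in> Obj \<A>" for P X Y Z
    using that by (simp add: induced_braiding_eq induced_assoc rwhisker_comp \<sigma>_tensor_left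
        A.rewrite2[OF \<sigma>_natural_rwhisker])
  moreover have "(P \<rtimes> Ja (s X Y Z)) \<bullet> Assoc S P (X \<star> Jo Y) Z \<bullet> (Assoc S P X Y \<ltimes> Jo Z)
      = Assoc S P (X \<star> Jo Z) Y \<bullet> (Assoc S P X Z \<ltimes> Jo Y) \<bullet> s (P \<star> Jo X) Y Z"
    if "P \<in> Obj \<A>" "X \<in> Obj \<A>" "Y \<in> Obj \<A>" "Z \<in> Obj \<A>" for P X Y Z
    using that by (simp add: induced_braiding_eq induced_assoc rwhisker_comp \<sigma>_strength)
  moreover have "s (P \<star> Jo Z) X Y \<bullet> (s P X Z \<ltimes> Jo Y) \<bullet> s (P \<star> Jo X) Y Z
      = (s P Y Z \<ltimes> Jo X) \<bullet> s (P \<star> Jo Y) X Z \<bullet> (s P X Y \<ltimes> Jo Z)"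
    if "P \<in> Obj \<A>" "X \<in> Obj \<A>" "Y \<in> Obj \<A>" "Z \<in> Obj \<A>" for P X Y Z
    using that by (simp add: induced_braiding_eq \<sigma>_yang_baxter)
  ultimately show ?thesis
    by (intro right_braiding.intro right_braiding_axioms.intro S.left_skew_monoidal_category_axioms)
      simp_all
qed

theorem induced_right_symmetry:
  assumes "symmetric_monoidal_category V c"
  shows "right_symmetry S s"
proof -
  interpret symmetric_monoidal_category V c by fact
  interpret S: right_braiding S s by (rule induced_right_braiding)
  show ?thesis
    by unfold_locales (simp add: induced_braiding_eq \<sigma>_symmetric braid_symmetry)
qed

end

theorem proposition6p2:
  fixes V :: "('x, 'g) tensor_cat" and c :: "'x \<Rightarrow> 'x \<Rightarrow> 'g"
    and \<A> :: "('a, 'f) cat" and T :: "('a, 'f, 'x, 'g) action"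
    and J :: 'a and Jo :: "'a \<Rightarrow> 'x" and Ja :: "'f \<Rightarrow> 'g"
    and \<eta> :: "'x \<Rightarrow> 'g" and \<epsilon> :: "'a \<Rightarrow> 'f"
  assumes "braided_monoidal_category V c"
    and "strong_right_actegory V \<A> T"
    and "J \<in> Obj \<A>"
    and "adjunction V \<A> (\<lambda>X. J \<star>\<^bsub>T\<^esub> X) (\<lambda>g. \<one>\<^bsub>\<A>\<^esub> J \<circledast>\<^bsub>T\<^esub> g) Jo Ja \<eta> \<epsilon>"
  shows "right_braiding (induced_skew V \<A> T J Jo Ja \<eta> \<epsilon>) (induced_braiding \<A> T c Jo)
    \<and> (symmetric_monoidal_category V c \<longrightarrow>
        right_symmetry (induced_skew V \<A> T J Jo Ja \<eta> \<epsilon>) (induced_braiding \<A> T c Jo))"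
proof -
  interpret braided_actegory_right_adjoint V \<A> T J Jo Ja \<eta> \<epsilon> c
    using assms
    by (intro braided_actegory_right_adjoint.intro actegory_right_adjoint.intro
        actegory_right_adjoint_axioms.intro braided_actegory.intro)
  show ?thesis using induced_right_braiding induced_right_symmetry by blast
qed

end
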